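(* Let $H\in(0,1)$, $\theta>0$, let $X$ be the sub-fractional Ornstein–Uhlenbeck process described in the context, and set $$f_H(\theta):=\frac{H\Gamma(2H)}{\theta^{2H}}.$$ Then there is a constant $C>0$ such that for every $t>0$ $$|E[X_t^2]-f_H(\theta)|\le C\,t^{2H-2}.$$ Hence there is a constant $C>0$, not depending on $n$, such that for all integers $n>1$ $$\sqrt n\,|A_n(X)-f_H(\theta)|\le\frac{C}{\sqrt n}\sum_{i=1}^ni^{2H-2},$$ and $\sqrt n\,|A_n(X)-f_H(\theta)|$ is bounded by $$C\begin{cases}n^{-1/2}&\text{if }0<H<1/2,\\ n^{-1/2}\log(n)&\text{if }H=1/2,\\ n^{2H-3/2}&\text{if }H>1/2.\end{cases}$$ In particular, if $0<H<3/4$, then $\sqrt n\,|A_n(X)-f_H(\theta)|\to0$ as $n\to\infty$.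
   Context: The sub-fractional Brownian motion $S^H=\{S^H_t\}_{t\ge0}$ with parameter $H\in(0,1)$ is the mean-zero continuous Gaussian process with covariance $E(S^H_tS^H_s)=t^{2H}+s^{2H}-\frac12\left((t+s)^{2H}+|t-s|^{2H}\right)$. The process $X$ solves $dX_t=-\theta X_tdt+dS^H_t$, $X_0=0$, i.e. $X_t=e^{-\theta t}\int_0^te^{\theta s}dS^H_s=S^H_t-\theta e^{-\theta t}\int_0^te^{\theta s}S^H_sds$ (Young/Wiener integral). $A_n(X):=\frac1n\sum_{i=1}^nE[X_i^2]$, using the discrete values $X_1,\dots,X_n$. *)

theory Defs
  imports "HOL-Probability.Probability"
begin

text \<open>
  The one-dimensional Gaussian laws are taken as the laws of \<open>\<mu> + \<sigma> Z\<close> with \<open>Z\<close> standard normal, so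
  that degenerate laws (\<open>\<sigma> = 0\<close>) are included: the process studied here vanishes at time 0, and
  linear combinations of its values may be constant.
\<close>

definition gaussian_process :: "'a measure \<Rightarrow> real set \<Rightarrow> (real \<Rightarrow> 'a \<Rightarrow> real) \<Rightarrow> bool" where
  "gaussian_process M I Y \<longleftrightarrow>
     prob_space M \<and>
     (\<forall>t\<in>I. Y t \<in> borel_measurable M) \<and>
     (\<forall>T c. finite T \<and> T \<subseteq> I \<longrightarrow>
        (\<exists>\<mu> \<sigma>. distr M borel (\<lambda>\<omega>. \<Sum>t\<in>T. c t * Y t \<omega>) =
                distr std_normal_distribution borel (\<lambda>z. \<mu> + \<sigma> * z)))"

definition sub_fractional_BM :: "'a measure \<Rightarrow> real \<Rightarrow> (real \<Rightarrow> 'a \<Rightarrow> real) \<Rightarrow> bool" where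
  "sub_fractional_BM M H S \<longleftrightarrow>
     gaussian_process M {0..} S \<and>
     (AE \<omega> in M. continuous_on {0..} (\<lambda>t. S t \<omega>)) \<and>
     (\<forall>t\<ge>0. (\<integral>\<omega>. S t \<omega> \<partial>M) = 0) \<and>
     (\<forall>t\<ge>0. \<forall>s\<ge>0. (\<integral>\<omega>. S t \<omega> * S s \<omega> \<partial>M) =
        t powr (2 * H) + s powr (2 * H)
          - 1 / 2 * ((t + s) powr (2 * H) + \<bar>t - s\<bar> powr (2 * H)))"

text \<open>
  The equation \<open>dx\<^sub>t = - \<theta> x\<^sub>t dt + ds\<^sub>t\<close>, \<open>x\<^sub>0 = 0\<close>, for a single path: the noise is additive, so it
  is an ordinary integral equation. The lemma after the definition identifies its unique continuous
  solution.
\<close>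

definition langevin_solution :: "real \<Rightarrow> (real \<Rightarrow> real) \<Rightarrow> (real \<Rightarrow> real) \<Rightarrow> bool" where
  "langevin_solution \<theta> s x \<longleftrightarrow>
     continuous_on {0..} x \<and> x 0 = 0 \<and>
     (\<forall>t\<ge>0. x t - x 0 = - \<theta> * integral {0..t} x + (s t - s 0))"

lemma langevin_solution_iff:
  fixes s x :: "real \<Rightarrow> real"
  assumes s: "continuous_on {0..} s" and s0: "s 0 = 0"
  shows "langevin_solution \<theta> s x \<longleftrightarrow>
    (\<forall>t\<ge>0. x t = s t - \<theta> * exp (- \<theta> * t) * integral {0..t} (\<lambda>r. exp (\<theta> * r) * s r))"
proof -
  define I where "I t = integral {0..t} (\<lambda>r. exp (\<theta> * r) * s r)" for t
  define Z where "Z t = exp (- \<theta> * t) * I t" for t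
  have I': "(I has_real_derivative exp (\<theta> * u) * s u) (at u within {0..t})" if "u \<in> {0..t}" for u t
  proof -
    have "continuous_on {0..t} (\<lambda>r. exp (\<theta> * r) * s r)"
      by (intro continuous_intros continuous_on_subset[OF s]) auto
    from integral_has_vector_derivative[OF this that] show ?thesis
      by (simp add: I_def[abs_def] has_real_derivative_iff_has_vector_derivative)
  qed
  have Z': "(Z has_real_derivative (s u - \<theta> * Z u)) (at u within {0..t})" if "u \<in> {0..t}" for u t
    unfolding Z_def
    by (rule derivative_eq_intros I'[OF that] refl)+
       (simp add: algebra_simps flip: exp_add)
  have Z0: "Z 0 = 0" by (simp add: Z_def I_def)
  show ?thesis
  proof
    assume L: "langevin_solution \<theta> s x"
    define Y where "Y t = integral {0..t} x" for t
    have x: "x t = s t - \<theta> * Y t" if "t \<ge> 0" for t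
      using L that s0 unfolding langevin_solution_def Y_def by auto
    have Y': "(Y has_real_derivative x u) (at u within {0..t})" if "u \<in> {0..t}" for u t
    proof -
      have "continuous_on {0..t} x"
        using L unfolding langevin_solution_def by (auto intro: continuous_on_subset)
      from integral_has_vector_derivative[OF this that] show ?thesis
        by (simp add: Y_def[abs_def] has_real_derivative_iff_has_vector_derivative)
    qed
    have "Y t = Z t" if "t \<ge> 0" for t
    proof -
      have "((\<lambda>u. exp (\<theta> * u) * Y u) has_vector_derivative exp (\<theta> * u) * s u) (at u within {0..t})"
        if "u \<in> {0..t}" for u
      proof -
        have "((\<lambda>u. exp (\<theta> * u) * Y u) has_real_derivative exp (\<theta> * u) * s u) (at u within {0..t})"
          using that
          by (auto intro!: derivative_eq_intros Y'[OF that] simp: x algebra_simps)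
        then show ?thesis by (simp add: has_real_derivative_iff_has_vector_derivative)
      qed
      from fundamental_theorem_of_calculus[OF that this]
      have "((\<lambda>u. exp (\<theta> * u) * s u) has_integral (exp (\<theta> * t) * Y t)) {0..t}"
        by (simp add: Y_def)
      then have "I t = exp (\<theta> * t) * Y t"
        unfolding I_def by (rule integral_unique)
      then show ?thesis by (simp add: Z_def exp_minus)
    qed
    then show "\<forall>t\<ge>0. x t = s t - \<theta> * exp (- \<theta> * t) * integral {0..t} (\<lambda>r. exp (\<theta> * r) * s r)"
      using x by (simp add: Z_def I_def)
  next
    assume "\<forall>t\<ge>0. x t = s t - \<theta> * exp (- \<theta> * t) * integral {0..t} (\<lambda>r. exp (\<theta> * r) * s r)"
    then have x: "x t = s t - \<theta> * Z t" if "t \<ge> 0" for t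
      using that by (simp add: Z_def I_def)
    have int: "integral {0..t} x = Z t" if "t \<ge> 0" for t
    proof -
      have "(Z has_vector_derivative x u) (at u within {0..t})" if "u \<in> {0..t}" for u
        using Z'[OF that] x[of u] that by (simp add: has_real_derivative_iff_has_vector_derivative)
      from fundamental_theorem_of_calculus[OF that this] show ?thesis
        by (simp add: Z0 integral_unique)
    qed
    have "continuous_on {0..} Z"
      unfolding continuous_on_eq_continuous_within
    proof
      fix u :: real assume u: "u \<in> {0..}"
      have "continuous (at u within {0..u + 1}) Z"
        using u by (intro DERIV_continuous[OF Z']) auto
      moreover have "at u within {0..u + 1} = at u within {0..}"
        by (rule at_within_nhd[where S = "{u - 1<..<u + 1}"]) auto
      ultimately show "continuous (at u within {0..}) Z" by simp
    qed
    then have "continuous_on {0..} (\<lambda>t. s t - \<theta> * Z t)"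
      by (intro continuous_intros s)
    then have "continuous_on {0..} x"
      by (rule continuous_on_eq) (simp add: x)
    then show "langevin_solution \<theta> s x"
      unfolding langevin_solution_def using int x s0 Z0 by simp
  qed
qed

definition sub_fractional_OU ::
    "'a measure \<Rightarrow> real \<Rightarrow> (real \<Rightarrow> 'a \<Rightarrow> real) \<Rightarrow> (real \<Rightarrow> 'a \<Rightarrow> real) \<Rightarrow> bool" where
  "sub_fractional_OU M \<theta> S X \<longleftrightarrow>
     (\<forall>t\<ge>0. X t \<in> borel_measurable M) \<and>
     (AE \<omega> in M. langevin_solution \<theta> (\<lambda>t. S t \<omega>) (\<lambda>t. X t \<omega>))"

definition mean_second_moment :: "'a measure \<Rightarrow> (real \<Rightarrow> 'a \<Rightarrow> real) \<Rightarrow> nat \<Rightarrow> real" where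
  "mean_second_moment M X n = 1 / real n * (\<Sum>i=1..n. \<integral>\<omega>. (X (real i) \<omega>)\<^sup>2 \<partial>M)"

definition f_lim :: "real \<Rightarrow> real \<Rightarrow> real" where
  "f_lim H \<theta> = H * Gamma (2 * H) / \<theta> powr (2 * H)"

end

theory Submission
  imports Defs "HOL-Real_Asymp.Real_Asymp"
begin

text \<open>
  Write \<open>p = 2H\<close> and \<open>J\<^sub>t = \<integral>\<^sub>0\<^sup>t e\<^bsup>\<theta>r\<^esup> S\<^sub>r dr\<close>, so that \<open>X\<^sub>t = S\<^sub>t - \<theta> e\<^bsup>-\<theta>t\<^esup> J\<^sub>t\<close>. Since
  \<open>J\<^sub>t\<^sup>2 = 2 \<integral>\<^sub>0\<^sup>t e\<^bsup>\<theta>u\<^esup> S\<^sub>u J\<^sub>u du\<close> along each path, Fubini reduces \<open>E[X\<^sub>t\<^sup>2]\<close> to one-dimensional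
  integrals of the covariance, all of which are expressed through \<open>\<integral>\<^sub>0\<^sup>x e\<^bsup>\<theta>w\<^esup> w\<^sup>p dw\<close> and its primitive.
  Up to exponentially small terms, \<open>E[X\<^sub>t\<^sup>2]\<close> is \<open>\<theta>/2 \<integral>\<^sub>0\<^sup>t e\<^bsup>-\<theta>s\<^esup> s\<^sup>p ds\<close>, which tends to the limit
  \<open>\<theta>/2 \<Gamma>(p + 1) / \<theta>\<^bsup>p+1\<^esup>\<close>, minus \<open>\<psi>(2t)/2\<close>, where \<open>\<psi>\<close> is obtained from \<open>x\<^sup>p\<close> by applying
  \<open>g \<mapsto> g - \<theta> e\<^bsup>-\<theta>x\<^esup> \<integral>\<^sub>0\<^sup>x e\<^bsup>\<theta>w\<^esup> g(w) dw\<close> twice. On power-like functions each application gains a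
  factor \<open>1/x\<close>, because its value \<open>u\<close> solves \<open>u' = g' - \<theta>u\<close>; hence \<open>\<psi>(x) = O(x\<^bsup>p-2\<^esup>)\<close>.
\<close>

section \<open>Growth of solutions of a damped linear equation\<close>

text \<open>For large \<open>x\<close> the relative slope \<open>q / x\<close> of
  \<open>x powr q\<close> is negligible against the damping rate \<open>\<theta>\<close>, so a large
  multiple of \<open>x powr q\<close> stays above the solution once it is above it at one point. The
  sign of \<open>q\<close> is free; both \<open>p\<close> and \<open>p - 2\<close> occur
  below.\<close>

lemma linear_ode_bigo_powr:
  fixes u f :: "real \<Rightarrow> real"
  assumes \<theta>: "\<theta> > 0"
    and u: "\<And>x. x > 0 \<Longrightarrow> (u has_real_derivative f x - \<theta> * u x) (at x)"
    and f: "f \<in> O(\<lambda>x. x powr q)"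
  shows "u \<in> O(\<lambda>x. x powr q)"
proof -
  obtain A where A: "A > 0" "\<forall>\<^sub>F x in at_top. norm (f x) \<le> A * norm (x powr q)"
    using f by (elim landau_o.bigE)
  have "((\<lambda>x. q / x) \<longlongrightarrow> 0) at_top" by real_asymp
  then have "\<forall>\<^sub>F x in at_top. q / x > - \<theta> / 2"
    using \<theta> by (intro order_tendstoD) auto
  with A(2) eventually_gt_at_top[of 0]
  have "\<forall>\<^sub>F x in at_top. x > 0 \<and> \<bar>f x\<bar> \<le> A * x powr q \<and> q / x > - \<theta> / 2"
    by eventually_elim auto
  then obtain x0 where x0: "\<And>x. x \<ge> x0 \<Longrightarrow> x > 0 \<and> \<bar>f x\<bar> \<le> A * x powr q \<and> q / x > - \<theta> / 2"
    by (auto simp: eventually_at_top_linorder)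
  \<comment> \<open>The first entry gives \<open>A \<le> K * (\<theta> / 2)\<close>, which lets the
    barrier absorb the source \<open>f\<close>; the second puts the solution below the barrier at
    \<open>x0\<close>.\<close>
  define K where "K = max (2 * A / \<theta>) (\<bar>u x0\<bar> / x0 powr q)"
  have K: "2 * A / \<theta> \<le> K" "\<bar>u x0\<bar> \<le> K * x0 powr q"
    using x0[of x0] by (auto simp: K_def field_simps max_def)
  have K0: "K > 0"
    using A(1) \<theta> by (intro less_le_trans[OF _ K(1)]) auto
  txt \<open>The function \<open>K x\<^sup>q\<close> is a supersolution from \<open>x0\<close> on; \<open>c = \<plusminus>1\<close> gives both signs.\<close>
  have barrier: "c * u x \<le> K * x powr q" if x: "x \<ge> x0" and c: "\<bar>c\<bar> = 1" for x c :: real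
  proof -
    \<comment> \<open>The integrating factor removes \<open>u\<close> from the derivative of the
      gap, so that only \<open>K\<close> has to be compared with \<open>f\<close>.\<close>
    let ?g = "\<lambda>x. exp (\<theta> * x) * (K * x powr q - c * u x)"
    have "?g x0 \<le> ?g x"
    proof (rule DERIV_nonneg_imp_nondecreasing[OF x])
      fix y assume y: "x0 \<le> y" "y \<le> x"
      then have y0: "y > 0" and fy: "\<bar>f y\<bar> \<le> A * y powr q" and qy: "q / y > - \<theta> / 2"
        using x0[of y] by auto
      let ?D = "exp (\<theta> * y) * (K * y powr q * (q / y + \<theta>) - c * f y)"
      have 1: "(?g has_real_derivative ?D) (at y)"
        using y0 by (auto intro!: derivative_eq_intros u
             simp: powr_diff field_simps)
      have "A \<le> K * (q / y + \<theta>)"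
      proof -
        have "A \<le> K * (\<theta> / 2)" using K(1) \<theta> by (simp add: field_simps)
        also have "\<dots> \<le> K * (q / y + \<theta>)"
        proof (rule mult_left_mono)
          show "\<theta> / 2 \<le> q / y + \<theta>" using qy by linarith
        qed (use K0 in simp)
        finally show ?thesis .
      qed
      then have "A * y powr q \<le> K * y powr q * (q / y + \<theta>)"
        using mult_right_mono[of A "K * (q / y + \<theta>)" "y powr q"] by (simp add: mult_ac)
      moreover have "c * f y \<le> \<bar>f y\<bar>" using c by (metis abs_ge_self abs_mult mult_1)
      ultimately have "0 \<le> ?D" using fy by simp
      with 1 show "\<exists>D. (?g has_real_derivative D) (at y) \<and> 0 \<le> D" by blast
    qed
    moreover have "c * u x0 \<le> \<bar>u x0\<bar>" using c by (metis abs_ge_self abs_mult mult_1)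
    then have "0 \<le> ?g x0" using K(2) by simp
    ultimately have "0 \<le> ?g x" by linarith
    then show ?thesis by (simp add: zero_le_mult_iff)
  qed
  have "\<forall>\<^sub>F x in at_top. norm (u x) \<le> K * norm (x powr q)"
    using eventually_ge_at_top[of x0]
  proof eventually_elim
    case (elim x)
    then show ?case using barrier[of x 1] barrier[of x "-1"] by (simp add: abs_le_iff)
  qed
  then show ?thesis by (rule landau_o.bigI[rotated]) (rule K0)
qed

section \<open>Joint measurability and Fubini for continuous processes\<close>

text \<open>Time is rounded down to the grid of mesh \<open>1 / Suc n\<close>. Only countably many
  times then occur, which gives joint measurability, and path continuity gives the pointwise
  limit.\<close>

lemma borel_measurable_continuous_process:
  fixes Y :: "real \<Rightarrow> 'a \<Rightarrow> real"
  assumes meas: "\<And>u. Y u \<in> borel_measurable M"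
    and cont: "\<And>\<omega>. \<omega> \<in> space M \<Longrightarrow> continuous_on UNIV (\<lambda>u. Y u \<omega>)"
  shows "(\<lambda>(u, \<omega>). Y u \<omega>) \<in> borel_measurable (lborel \<Otimes>\<^sub>M M)"
proof (rule borel_measurable_LIMSEQ_real)
  let ?d = "\<lambda>n (u :: real). of_int \<lfloor>real (Suc n) * u\<rfloor> / real (Suc n)"
  show "(\<lambda>z. Y (?d n (fst z)) (snd z)) \<in> borel_measurable (lborel \<Otimes>\<^sub>M M)" for n
  proof -
    note [measurable] = meas
    show ?thesis
      by (rule measurable_compose_countable
          [where f = "\<lambda>i z. Y (of_int i / real (Suc n)) (snd z)" and g = "\<lambda>z. \<lfloor>real (Suc n) * fst z\<rfloor>"])
         measurable
  qed
  fix z :: "real \<times> 'a" assume z: "z \<in> space (lborel \<Otimes>\<^sub>M M)"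
  obtain u \<omega> where [simp]: "z = (u, \<omega>)" by (cases z)
  have "(\<lambda>n. ?d n u) \<longlonglongrightarrow> u"
  proof (rule LIM_zero_cancel, rule Lim_null_comparison)
    have "norm (?d n u - u) \<le> 1 / real (Suc n)" for n
    proof -
      have "\<bar>of_int \<lfloor>real (Suc n) * u\<rfloor> - real (Suc n) * u\<bar> \<le> 1" by linarith
      then have "\<bar>of_int \<lfloor>real (Suc n) * u\<rfloor> - real (Suc n) * u\<bar> / real (Suc n) \<le> 1 / real (Suc n)"
        by (intro divide_right_mono) auto
      also have "\<bar>of_int \<lfloor>real (Suc n) * u\<rfloor> - real (Suc n) * u\<bar> / real (Suc n) = \<bar>?d n u - u\<bar>"
        by (subst abs_div_pos) (simp_all add: diff_divide_distrib del: of_nat_Suc)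
      finally show ?thesis by simp
    qed
    then show "\<forall>\<^sub>F n in sequentially. norm (?d n u - u) \<le> 1 / real (Suc n)" by simp
    show "(\<lambda>n. 1 / real (Suc n)) \<longlonglongrightarrow> 0" by real_asymp
  qed
  moreover have "isCont (\<lambda>u. Y u \<omega>) u"
    using cont[of \<omega>] z by (auto simp: continuous_on_eq_continuous_at space_pair_measure)
  ultimately show "(\<lambda>n. Y (?d n (fst z)) (snd z)) \<longlonglongrightarrow> (\<lambda>(u, \<omega>). Y u \<omega>) z"
    by (auto intro: isCont_tendsto_compose[of u "\<lambda>u. Y u \<omega>"])
qed

text \<open>The bound \<open>B\<close>, uniform over a time interval of finite length, yields
  integrability for the product measure, and Fubini applies. The gauge integral along a path is
  first identified with the Lebesgue integral.\<close>

lemma (in prob_space) expectation_integral_continuous_process: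
  fixes Y :: "real \<Rightarrow> 'a \<Rightarrow> real"
  assumes meas: "\<And>u. Y u \<in> borel_measurable M"
    and cont: "\<And>\<omega>. \<omega> \<in> space M \<Longrightarrow> continuous_on UNIV (\<lambda>u. Y u \<omega>)"
    and int: "\<And>u. u \<in> {0..t} \<Longrightarrow> integrable M (Y u)"
    and bound: "\<And>u. u \<in> {0..t} \<Longrightarrow> expectation (\<lambda>\<omega>. \<bar>Y u \<omega>\<bar>) \<le> B"
  shows "integrable M (\<lambda>\<omega>. integral {0..t} (\<lambda>u. Y u \<omega>))"
    and "expectation (\<lambda>\<omega>. integral {0..t} (\<lambda>u. Y u \<omega>)) = integral {0..t} (\<lambda>u. expectation (Y u))"
proof -
  interpret L: pair_sigma_finite lborel M ..
  note [measurable] = borel_measurable_continuous_process[OF meas cont]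
  let ?f = "\<lambda>(u, \<omega>). indicat_real {0..t} u * Y u \<omega>"
  have m: "?f \<in> borel_measurable (lborel \<Otimes>\<^sub>M M)"
    using borel_measurable_continuous_process[OF meas cont] by (simp add: case_prod_beta')
  have "integrable lborel (\<lambda>u. \<integral>\<omega>. norm (?f (u, \<omega>)) \<partial>M)"
  proof (rule Bochner_Integration.integrable_bound)
    show "integrable lborel (\<lambda>u. indicat_real {0..t} u * \<bar>B\<bar>)"
      using borel_integrable_atLeastAtMost'[of 0 t "\<lambda>_. \<bar>B\<bar>"] by (simp add: set_integrable_def)
    show "(\<lambda>u. \<integral>\<omega>. norm (?f (u, \<omega>)) \<partial>M) \<in> borel_measurable lborel"
      using m by measurable
    have "norm (\<integral>\<omega>. norm (?f (u, \<omega>)) \<partial>M) \<le> norm (indicat_real {0..t} u * \<bar>B\<bar>)" for u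
      using bound[of u] by (auto simp: indicator_def abs_mult)
    then show "AE u in lborel. norm (\<integral>\<omega>. norm (?f (u, \<omega>)) \<partial>M) \<le> norm (indicat_real {0..t} u * \<bar>B\<bar>)"
      by simp
  qed
  moreover have "AE u in lborel. integrable M (\<lambda>\<omega>. ?f (u, \<omega>))"
    using int by (auto simp: indicator_def)
  ultimately have I: "integrable (lborel \<Otimes>\<^sub>M M) ?f"
    by (rule L.Fubini_integrable[OF m])
  have path: "integral {0..t} (\<lambda>u. Y u \<omega>) = (\<integral>u. ?f (u, \<omega>) \<partial>lborel)" if "\<omega> \<in> space M" for \<omega>
  proof -
    have "set_integrable lborel {0..t} (\<lambda>u. Y u \<omega>)"
      using cont[OF that] by (intro borel_integrable_atLeastAtMost') (auto intro: continuous_on_subset)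
    from set_borel_integral_eq_integral(2)[OF this] show ?thesis
      by (simp add: set_lebesgue_integral_def)
  qed
  have "integrable M (\<lambda>\<omega>. \<integral>u. ?f (u, \<omega>) \<partial>lborel)"
    by (rule L.integrable_snd[of "\<lambda>u \<omega>. ?f (u, \<omega>)"]) (use I in simp)
  then show "integrable M (\<lambda>\<omega>. integral {0..t} (\<lambda>u. Y u \<omega>))"
    by (subst Bochner_Integration.integrable_cong[OF refl path]) auto
  have "set_integrable lborel {0..t} (\<lambda>u. expectation (Y u))"
    unfolding set_integrable_def using L.integrable_fst[OF I] by simp
  note E = set_borel_integral_eq_integral(2)[OF this]
  have "expectation (\<lambda>\<omega>. integral {0..t} (\<lambda>u. Y u \<omega>)) = (\<integral>\<omega>. \<integral>u. ?f (u, \<omega>) \<partial>lborel \<partial>M)"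
    by (rule Bochner_Integration.integral_cong[OF refl path])
  also have "\<dots> = (\<integral>u. \<integral>\<omega>. ?f (u, \<omega>) \<partial>M \<partial>lborel)"
    by (rule L.Fubini_integral) (use I in simp)
  also have "\<dots> = integral {0..t} (\<lambda>u. expectation (Y u))"
    using E by (simp add: set_lebesgue_integral_def)
  finally show "expectation (\<lambda>\<omega>. integral {0..t} (\<lambda>u. Y u \<omega>)) = integral {0..t} (\<lambda>u. expectation (Y u))" .
qed

section \<open>Partial sums of powers\<close>

text \<open>Integral comparison in telescoping form: by the mean value theorem and monotonicity of
  \<open>x powr q\<close>, each term is at most an increment of the primitive
  \<open>x powr (q + 1) / (q + 1)\<close>.\<close>

lemma sum_powr_le_neg:
  fixes q :: real
  assumes "-1 < q" "q \<le> 0"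
  shows "(\<Sum>i=1..n. real i powr q) \<le> real n powr (q + 1) / (q + 1)"
proof (induction n)
  case (Suc n)
  have "real (Suc n) powr q \<le> (real (Suc n) powr (q + 1) - real n powr (q + 1)) / (q + 1)"
  proof (cases "n = 0")
    case True with assms show ?thesis by (simp add: field_simps)
  next
    case False
    have "\<exists>z. real n < z \<and> z < real (Suc n) \<and> real (Suc n) powr (q + 1) - real n powr (q + 1)
        = (real (Suc n) - real n) * ((q + 1) * z powr q)"
      by (rule MVT2) (use False in \<open>auto intro!: derivative_eq_intros\<close>)
    then obtain z where z: "real n < z" "z < real (Suc n)"
      "real (Suc n) powr (q + 1) - real n powr (q + 1) = (q + 1) * z powr q" by auto
    have "real (Suc n) powr q \<le> z powr q"
      using z assms by (intro powr_mono2') auto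
    then have "(q + 1) * real (Suc n) powr q \<le> (q + 1) * z powr q"
      using assms by (intro mult_left_mono) auto
    then show ?thesis using z(3) assms by (simp add: pos_le_divide_eq mult.commute)
  qed
  with Suc show ?case by (simp add: diff_divide_distrib)
qed (use assms in auto)

lemma summable_sum_powr_bound:
  fixes q :: real
  assumes "q < -1"
  obtains C where "\<And>n. (\<Sum>i=1..n. real i powr q) \<le> C" "C > 0"
proof -
  have "summable (\<lambda>i. real i powr q)" using assms by (simp add: summable_real_powr_iff)
  then have le: "(\<Sum>i=1..n. real i powr q) \<le> (\<Sum>i. real i powr q)" for n
    by (rule sum_le_suminf) auto
  have "(\<Sum>i. real i powr q) > 0" using le[of 1] by simp
  with le that show thesis by blast
qed

section \<open>Calculus on the half-line\<close>

text \<open>Derivatives are asked for in the open interval only: the primitives below are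
  differentiated at positive arguments, since powers with small exponent have no derivative at
  0.\<close>

lemma fundamental_theorem_of_calculus_interior_real:
  fixes f f' :: "real \<Rightarrow> real"
  assumes "a \<le> b" "continuous_on {a..b} f"
    and "\<And>x. a < x \<Longrightarrow> x < b \<Longrightarrow> (f has_real_derivative f' x) (at x)"
  shows "(f' has_integral f b - f a) {a..b}"
  using assms
  by (intro fundamental_theorem_of_calculus_interior)
     (auto simp: has_real_derivative_iff_has_vector_derivative)

lemma continuous_on_integral_atLeast:
  fixes h :: "real \<Rightarrow> real"
  assumes h: "continuous_on {0..} h"
  shows "continuous_on {0..} (\<lambda>x. integral {0..x} h)"
  unfolding continuous_on_eq_continuous_within
proof
  fix x :: real assume x: "x \<in> {0..}"
  have "continuous_on {0..x+1} (\<lambda>x. integral {0..x} h)"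
    using h by (intro indefinite_integral_continuous_1 integrable_continuous_real)
               (auto intro: continuous_on_subset)
  then have "continuous (at x within {0..x+1}) (\<lambda>x. integral {0..x} h)"
    using x by (auto simp: continuous_on_eq_continuous_within)
  moreover have "at x within {0..x + 1} = at x within {0..}"
    using x by (intro at_within_nhd[where S = "{x - 1<..<x + 1}"]) auto
  ultimately show "continuous (at x within {0..}) (\<lambda>x. integral {0..x} h)" by simp
qed

lemma integral_has_real_derivative_atLeast:
  fixes h :: "real \<Rightarrow> real"
  assumes h: "continuous_on {0..} h" and x: "x > 0"
  shows "((\<lambda>x. integral {0..x} h) has_real_derivative h x) (at x)"
proof -
  have "((\<lambda>x. integral {0..x} h) has_real_derivative h x) (at x within {0..x+1})"
    using x integral_has_vector_derivative[of 0 "x+1" h x] continuous_on_subset[OF h, of "{0..x+1}"]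
    by (auto simp: has_real_derivative_iff_has_vector_derivative)
  moreover have "at x within {0..x+1} = at x"
    using x by (intro at_within_interior) (auto simp: interior_atLeastAtMost_real)
  ultimately show ?thesis by simp
qed

section \<open>Incomplete gamma integrals\<close>

text \<open>For a negative rate this is a rescaled lower incomplete gamma function at
  \<open>p + 1\<close>. Both signs of the rate occur: the reflection \<open>w = t - r\<close> in the
  covariance turns \<open>\<theta>\<close> into \<open>- \<theta>\<close>.\<close>

definition exp_powr_int :: "real \<Rightarrow> real \<Rightarrow> real \<Rightarrow> real" where
  "exp_powr_int \<theta> p x = integral {0..x} (\<lambda>w. exp (\<theta> * w) * w powr p)"

definition exp_powr_int2 :: "real \<Rightarrow> real \<Rightarrow> real \<Rightarrow> real" where
  "exp_powr_int2 \<theta> p x = integral {0..x} (exp_powr_int \<theta> p)"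

lemma continuous_on_powr_atLeast:
  "p > 0 \<Longrightarrow> continuous_on {0..} (\<lambda>x::real. x powr p)"
  by (intro continuous_on_powr' continuous_intros) auto

lemma continuous_exp_powr_int:
  assumes "p > 0"
  shows "continuous_on {0..} (exp_powr_int \<theta> p)" "continuous_on {0..} (exp_powr_int2 \<theta> p)"
proof -
  show 1: "continuous_on {0..} (exp_powr_int \<theta> p)"
    unfolding exp_powr_int_def
    by (intro continuous_on_integral_atLeast continuous_intros continuous_on_powr_atLeast assms)
  show "continuous_on {0..} (exp_powr_int2 \<theta> p)"
    unfolding exp_powr_int2_def by (intro continuous_on_integral_atLeast 1)
qed

lemmas continuous_exp_powr_int_compose =
  continuous_on_compose2[OF continuous_exp_powr_int(1)]
  continuous_on_compose2[OF continuous_exp_powr_int(2)]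
  continuous_on_compose2[OF continuous_on_powr_atLeast]

lemma exp_powr_int_0 [simp]: "exp_powr_int \<theta> p 0 = 0" "exp_powr_int2 \<theta> p 0 = 0"
  by (simp_all add: exp_powr_int_def exp_powr_int2_def)

lemma DERIV_exp_powr_int:
  assumes "p > 0" "x > 0"
  shows "(exp_powr_int \<theta> p has_real_derivative exp (\<theta> * x) * x powr p) (at x)"
    and "(exp_powr_int2 \<theta> p has_real_derivative exp_powr_int \<theta> p x) (at x)"
proof -
  have "continuous_on {0..} (\<lambda>w. exp (\<theta> * w) * w powr p)"
    by (intro continuous_intros continuous_on_powr_atLeast assms)
  from integral_has_real_derivative_atLeast[OF this assms(2)]
  show "(exp_powr_int \<theta> p has_real_derivative exp (\<theta> * x) * x powr p) (at x)"
    by (simp add: exp_powr_int_def[abs_def])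
  from integral_has_real_derivative_atLeast[OF continuous_exp_powr_int(1)[OF assms(1)] assms(2)]
  show "(exp_powr_int2 \<theta> p has_real_derivative exp_powr_int \<theta> p x) (at x)"
    by (simp add: exp_powr_int2_def[abs_def])
qed

section \<open>Integrals of the covariance\<close>

definition sfbm_cov :: "real \<Rightarrow> real \<Rightarrow> real \<Rightarrow> real" where
  "sfbm_cov p t s = t powr p + s powr p - 1 / 2 * ((t + s) powr p + \<bar>t - s\<bar> powr p)"

text \<open>With \<open>J\<close> as above, \<open>sfbm_cov_int\<close> and \<open>weighted_moment\<close> are closed forms of
  \<open>E[S\<^sub>t J\<^sub>t]\<close> and \<open>E[J\<^sub>t\<^sup>2]\<close>.\<close>

definition sfbm_cov_int :: "real \<Rightarrow> real \<Rightarrow> real \<Rightarrow> real" where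
  "sfbm_cov_int \<theta> p t = t powr p * (exp (\<theta> * t) - 1) / \<theta> + exp_powr_int \<theta> p t -
     1 / 2 * (exp (- \<theta> * t) * (exp_powr_int \<theta> p (2 * t) - exp_powr_int \<theta> p t) +
              exp (\<theta> * t) * exp_powr_int (- \<theta>) p t)"

lemma integral_sfbm_cov:
  assumes "p > 0" "\<theta> > 0" "t \<ge> 0"
  shows "integral {0..t} (\<lambda>r. exp (\<theta> * r) * sfbm_cov p t r) = sfbm_cov_int \<theta> p t"
proof -
  \<comment> \<open>The last two terms come from the substitutions \<open>w = t + r\<close> and
    \<open>w = t - r\<close>, which split \<open>exp (\<theta> * r)\<close> as
    \<open>exp (- \<theta> * t) * exp (\<theta> * w)\<close> and
    \<open>exp (\<theta> * t) * exp (- \<theta> * w)\<close>. On the interval the absolute value is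
    \<open>t - r\<close>.\<close>
  let ?G = "\<lambda>r. t powr p * exp (\<theta> * r) / \<theta> + exp_powr_int \<theta> p r
    - 1 / 2 * (exp (- \<theta> * t) * exp_powr_int \<theta> p (t + r) - exp (\<theta> * t) * exp_powr_int (- \<theta>) p (t - r))"
  have "((\<lambda>r. exp (\<theta> * r) * sfbm_cov p t r) has_integral ?G t - ?G 0) {0..t}"
  proof (rule fundamental_theorem_of_calculus_interior_real)
    show "continuous_on {0..t} ?G"
      by (intro continuous_intros continuous_exp_powr_int_compose[OF assms(1)]) (use assms in auto)
    fix r assume r: "0 < r" "r < t"
    show "(?G has_real_derivative exp (\<theta> * r) * sfbm_cov p t r) (at r)"
    proof -
      note E = DERIV_exp_powr_int(1)[OF assms(1)]
      have "(?G has_real_derivative t powr p * (exp (\<theta> * r) * \<theta>) / \<theta> + exp (\<theta> * r) * r powr p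
        - 1 / 2 * (exp (- \<theta> * t) * (exp (\<theta> * (t + r)) * (t + r) powr p * 1) -
           exp (\<theta> * t) * (exp (- \<theta> * (t - r)) * (t - r) powr p * - 1))) (at r)"
        using r assms
        by (intro DERIV_diff DERIV_add DERIV_cmult DERIV_cdivide E DERIV_chain2[OF E])
           (auto intro!: derivative_eq_intros)
      then show ?thesis
        by (rule DERIV_cong)
           (use r assms in \<open>simp add: sfbm_cov_def algebra_simps mult_exp_exp mult.left_commute[of "exp _"]\<close>)
    qed
  qed (use assms in auto)
  from integral_unique[OF this] show ?thesis
    by (simp add: sfbm_cov_int_def algebra_simps add_divide_distrib diff_divide_distrib)
qed

definition weighted_moment :: "real \<Rightarrow> real \<Rightarrow> real \<Rightarrow> real" where
  "weighted_moment \<theta> p t = 2 / \<theta> * exp (\<theta> * t) * exp_powr_int \<theta> p t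
     - 3 / (2 * \<theta>) * exp_powr_int \<theta> p t - 1 / 2 * exp_powr_int2 \<theta> p (2 * t) + exp_powr_int2 \<theta> p t
     - exp (2 * \<theta> * t) * exp_powr_int (- \<theta>) p t / (2 * \<theta>)"

text \<open>Integration by parts: the products of an exponential with \<open>exp_powr_int\<close>
  reproduce the integrand up to multiples of \<open>exp (\<theta> * u) * u powr p\<close>, and the
  coefficient \<open>3 / (2 * \<theta>)\<close> corrects these. The factor 1/2 before
  \<open>exp_powr_int2 \<theta> p (2 * t)\<close> compensates the inner derivative 2.\<close>

lemma integral_sfbm_cov_int:
  assumes "p > 0" "\<theta> > 0" "t \<ge> 0"
  shows "integral {0..t} (\<lambda>u. 2 * exp (\<theta> * u) * sfbm_cov_int \<theta> p u) = weighted_moment \<theta> p t"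
proof -
  have "((\<lambda>u. 2 * exp (\<theta> * u) * sfbm_cov_int \<theta> p u) has_integral
      weighted_moment \<theta> p t - weighted_moment \<theta> p 0) {0..t}"
  proof (rule fundamental_theorem_of_calculus_interior_real)
    show "continuous_on {0..t} (weighted_moment \<theta> p)"
      unfolding weighted_moment_def
      by (intro continuous_intros continuous_exp_powr_int_compose[OF assms(1)]) (use assms in auto)
    fix u assume u: "0 < u" "u < t"
    \<comment> \<open>With every exponential expressed through \<open>e\<close>, matching the
      derivatives becomes a rational identity.\<close>
    define e where "e = exp (\<theta> * u)"
    have e: "exp (2 * \<theta> * u) = e\<^sup>2" "exp (- \<theta> * u) = inverse e" "e > 0"
      "exp (\<theta> * (2 * u)) = e\<^sup>2"
      by (simp_all add: e_def exp_minus power2_eq_square flip: exp_add)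
    have d: "((\<lambda>u. exp (a * u)) has_real_derivative a * exp (a * u)) (at u)" for a
      by (auto intro!: derivative_eq_intros)
    have E: "(exp_powr_int a p has_real_derivative exp (a * u) * u powr p) (at u)" for a
      by (rule DERIV_exp_powr_int) (use u assms in auto)
    have E2: "(exp_powr_int2 \<theta> p has_real_derivative exp_powr_int \<theta> p u) (at u)"
      by (rule DERIV_exp_powr_int) (use u assms in auto)
    have E3: "((\<lambda>u. exp_powr_int2 \<theta> p (2 * u)) has_real_derivative exp_powr_int \<theta> p (2 * u) * 2) (at u)"
      by (rule DERIV_chain2[OF DERIV_exp_powr_int(2)]) (use u assms in \<open>auto intro!: derivative_eq_intros\<close>)
    note D = DERIV_diff[OF DERIV_add[OF DERIV_diff[OF DERIV_diff[OF
          DERIV_mult[OF DERIV_cmult[OF d, of "2 / \<theta>" \<theta>] E]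
          DERIV_cmult[OF E, of "3 / (2 * \<theta>)"]] DERIV_cmult[OF E3, of "1 / 2"]] E2]
          DERIV_cdivide[OF DERIV_mult[OF d[of "2 * \<theta>"] E[of "- \<theta>"]], of "2 * \<theta>"]]
    show "(weighted_moment \<theta> p has_real_derivative 2 * exp (\<theta> * u) * sfbm_cov_int \<theta> p u) (at u)"
      unfolding weighted_moment_def sfbm_cov_int_def e e_def[symmetric]
      by (rule DERIV_cong[OF D[unfolded e e_def[symmetric]]])
         (use assms e(3) e_def[symmetric] in \<open>simp add: field_simps power2_eq_square\<close>)
  qed (use assms in auto)
  from integral_unique[OF this] show ?thesis by (simp add: weighted_moment_def)
qed

section \<open>Decomposition of the second moment\<close>

definition sub_fOU_moment :: "real \<Rightarrow> real \<Rightarrow> real \<Rightarrow> real" where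
  "sub_fOU_moment \<theta> p t = sfbm_cov p t t - 2 * \<theta> * exp (- \<theta> * t) * sfbm_cov_int \<theta> p t
     + \<theta>\<^sup>2 * exp (- 2 * \<theta> * t) * weighted_moment \<theta> p t"

text \<open>The function \<open>\<psi>\<close> of the introduction.\<close>

definition remainder_fn :: "real \<Rightarrow> real \<Rightarrow> real \<Rightarrow> real" where
  "remainder_fn \<theta> p x = x powr p - 2 * \<theta> * exp (- \<theta> * x) * exp_powr_int \<theta> p x
     + \<theta>\<^sup>2 * exp (- \<theta> * x) * exp_powr_int2 \<theta> p x"

text \<open>The growing contributions \<open>2 * t powr p\<close> and \<open>2 * \<theta> * exp (-
  \<theta> * t) * exp_powr_int \<theta> p t\<close> each occur with both signs and cancel. The terms
  at \<open>2 * t\<close> assemble into \<open>remainder_fn\<close>, and the incomplete gamma terms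
  combine to \<open>\<theta> - \<theta> / 2 = \<theta> / 2\<close>.\<close>

lemma sub_fOU_moment_eq:
  assumes "p > 0" "\<theta> > 0" "t \<ge> 0"
  shows "sub_fOU_moment \<theta> p t =
    - 1 / 2 * remainder_fn \<theta> p (2 * t) + \<theta> / 2 * exp_powr_int (- \<theta>) p t + 2 * t powr p * exp (- \<theta> * t)
    + exp (- 2 * \<theta> * t) * (\<theta>\<^sup>2 * exp_powr_int2 \<theta> p t - 5 / 2 * \<theta> * exp_powr_int \<theta> p t)"
proof -
  define e i where "e = exp (\<theta> * t)" and "i = exp (- \<theta> * t)"
  have e: "exp (- 2 * \<theta> * t) = i\<^sup>2" "exp (2 * \<theta> * t) = e\<^sup>2" "exp (- \<theta> * (2 * t)) = i\<^sup>2"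
    by (simp_all add: e_def i_def power2_eq_square flip: exp_add)
  have ei: "i * e = 1" by (simp add: e_def i_def flip: exp_add)
  let ?T = "t powr p" and ?E = "exp_powr_int \<theta> p t" and ?E' = "exp_powr_int \<theta> p (2 * t)"
    and ?F = "exp_powr_int (- \<theta>) p t" and ?D = "exp_powr_int2 \<theta> p t" and ?D' = "exp_powr_int2 \<theta> p (2 * t)"
  have 1: "2 * \<theta> * i * sfbm_cov_int \<theta> p t =
    2 * ?T * (1 - i) + 2 * \<theta> * i * ?E - \<theta> * i\<^sup>2 * (?E' - ?E) - \<theta> * ?F"
  proof -
    have "2 * \<theta> * i * (?T * (e - 1) / \<theta> + ?E - 1 / 2 * (i * (?E' - ?E) + e * ?F)) =
      2 * (\<theta> * (?T * (i * e - i) / \<theta>)) + 2 * \<theta> * i * ?E - \<theta> * i\<^sup>2 * (?E' - ?E) - \<theta> * ?F * (i * e)"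
      by (simp add: algebra_simps power2_eq_square)
    then show ?thesis
      unfolding sfbm_cov_int_def e_def[symmetric] i_def[symmetric] using assms(2) ei by simp
  qed
  have 2: "\<theta>\<^sup>2 * i\<^sup>2 * weighted_moment \<theta> p t = 2 * \<theta> * i * ?E - 3 / 2 * \<theta> * i\<^sup>2 * ?E
     - 1 / 2 * \<theta>\<^sup>2 * i\<^sup>2 * ?D' + \<theta>\<^sup>2 * i\<^sup>2 * ?D - 1 / 2 * \<theta> * ?F"
  proof -
    \<comment> \<open>Writing \<open>q\<close> for the reciprocal keeps the identity polynomial; the
      relations \<open>\<theta> * q = 1\<close> and \<open>i * e = 1\<close> are applied only
      afterwards.\<close>
    define q where "q = 1 / \<theta>"
    have q: "2 / \<theta> = 2 * q" "3 / (2 * \<theta>) = 3 / 2 * q" "x / (2 * \<theta>) = 1 / 2 * q * x" "\<theta> * q = 1" for x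
      using assms(2) by (simp_all add: q_def)
    have "\<theta>\<^sup>2 * i\<^sup>2 * (2 / \<theta> * e * ?E - 3 / (2 * \<theta>) * ?E - 1 / 2 * ?D' + ?D - e\<^sup>2 * ?F / (2 * \<theta>)) =
      2 * \<theta> * (\<theta> * q) * i * (i * e) * ?E - 3 / 2 * \<theta> * (\<theta> * q) * i\<^sup>2 * ?E
      - 1 / 2 * \<theta>\<^sup>2 * i\<^sup>2 * ?D' + \<theta>\<^sup>2 * i\<^sup>2 * ?D - 1 / 2 * \<theta> * (\<theta> * q) * (i * e)\<^sup>2 * ?F"
      unfolding q(1-3) by (simp add: algebra_simps power2_eq_square)
    then show ?thesis
      unfolding weighted_moment_def e e_def[symmetric] using q(4) ei by simp
  qed
  have 3: "sfbm_cov p t t = 2 * t powr p - 1 / 2 * (2 * t) powr p"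
    by (simp add: sfbm_cov_def)
  show ?thesis
    unfolding sub_fOU_moment_def remainder_fn_def e i_def[symmetric] 1 2 3
    by (simp add: algebra_simps)
qed

lemma continuous_on_sub_fOU_moment:
  assumes p: "p > 0" and \<theta>: "\<theta> > 0"
  shows "continuous_on {0..} (sub_fOU_moment \<theta> p)"
proof -
  have "continuous_on {0..} (\<lambda>t. sfbm_cov p t t)"
    by (simp add: sfbm_cov_def) (intro continuous_intros continuous_exp_powr_int_compose[OF p]; force)
  moreover have "continuous_on {0..} (sfbm_cov_int \<theta> p)"
    unfolding sfbm_cov_int_def
    by (intro continuous_intros continuous_exp_powr_int_compose[OF p]) (use \<theta> in auto)
  moreover have "continuous_on {0..} (weighted_moment \<theta> p)"
    unfolding weighted_moment_def
    by (intro continuous_intros continuous_exp_powr_int_compose[OF p]) (use \<theta> in auto)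
  ultimately show ?thesis
    unfolding sub_fOU_moment_def by (intro continuous_intros)
qed

section \<open>Asymptotics for large time\<close>

lemma DERIV_damped_exp_powr_int:
  assumes "p > 0" "x > 0"
  shows "((\<lambda>x. exp (- \<theta> * x) * exp_powr_int \<theta> p x) has_real_derivative
      x powr p - \<theta> * (exp (- \<theta> * x) * exp_powr_int \<theta> p x)) (at x)"
    and "((\<lambda>x. exp (- \<theta> * x) * exp_powr_int2 \<theta> p x) has_real_derivative
      exp (- \<theta> * x) * exp_powr_int \<theta> p x - \<theta> * (exp (- \<theta> * x) * exp_powr_int2 \<theta> p x)) (at x)"
proof -
  have d: "((\<lambda>x. exp (- \<theta> * x)) has_real_derivative - \<theta> * exp (- \<theta> * x)) (at x)"
    by (auto intro!: derivative_eq_intros)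
  show "((\<lambda>x. exp (- \<theta> * x) * exp_powr_int \<theta> p x) has_real_derivative
      x powr p - \<theta> * (exp (- \<theta> * x) * exp_powr_int \<theta> p x)) (at x)"
    by (rule DERIV_cong[OF DERIV_mult[OF d DERIV_exp_powr_int(1)[OF assms]]]) (simp add: mult_exp_exp)
  show "((\<lambda>x. exp (- \<theta> * x) * exp_powr_int2 \<theta> p x) has_real_derivative
      exp (- \<theta> * x) * exp_powr_int \<theta> p x - \<theta> * (exp (- \<theta> * x) * exp_powr_int2 \<theta> p x)) (at x)"
    by (rule DERIV_cong[OF DERIV_mult[OF d DERIV_exp_powr_int(2)[OF assms]]]) simp
qed

text \<open>These crude orders suffice, because in \<open>sub_fOU_moment_eq\<close> both damped
  integrals carry one more factor \<open>exp (- \<theta> * t)\<close>.\<close>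

lemma exp_powr_int_bigo:
  assumes p: "p > 0" and \<theta>: "\<theta> > 0"
  shows "(\<lambda>x. exp (- \<theta> * x) * exp_powr_int \<theta> p x) \<in> O(\<lambda>x. x powr p)"
    and "(\<lambda>x. exp (- \<theta> * x) * exp_powr_int2 \<theta> p x) \<in> O(\<lambda>x. x powr p)"
proof -
  show 1: "(\<lambda>x. exp (- \<theta> * x) * exp_powr_int \<theta> p x) \<in> O(\<lambda>x. x powr p)"
    by (rule linear_ode_bigo_powr[OF \<theta> DERIV_damped_exp_powr_int(1)[OF p]]) auto
  show "(\<lambda>x. exp (- \<theta> * x) * exp_powr_int2 \<theta> p x) \<in> O(\<lambda>x. x powr p)"
    by (rule linear_ode_bigo_powr[OF \<theta> DERIV_damped_exp_powr_int(2)[OF p] 1])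
qed

text \<open>Bounding \<open>u = x powr p - \<theta> * k1 x\<close> alone is not enough: in
  \<open>u' = p * x powr (p - 1) - \<theta> * u\<close> the two terms on the right cancel to leading
  order. The corrected function \<open>?w\<close> makes this cancellation explicit.\<close>

lemma remainder_fn_bigo:
  assumes p: "p > 0" and \<theta>: "\<theta> > 0"
  shows "remainder_fn \<theta> p \<in> O(\<lambda>x. x powr (p - 2))"
proof -
  define k1 k2 where "k1 x = exp (- \<theta> * x) * exp_powr_int \<theta> p x"
    and "k2 x = exp (- \<theta> * x) * exp_powr_int2 \<theta> p x" for x
  have k: "(k1 has_real_derivative x powr p - \<theta> * k1 x) (at x)"
    "(k2 has_real_derivative k1 x - \<theta> * k2 x) (at x)" if "x > 0" for x
    using DERIV_damped_exp_powr_int[OF p that, of \<theta>] by (simp_all add: k1_def[abs_def] k2_def[abs_def])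
  have v: "remainder_fn \<theta> p = (\<lambda>x. x powr p - 2 * \<theta> * k1 x + \<theta>\<^sup>2 * k2 x)"
    by (simp add: fun_eq_iff remainder_fn_def k1_def k2_def)
  have dpow: "((\<lambda>x. x powr a) has_real_derivative a * x powr (a - 1)) (at x)" if "x > 0" for a x :: real
    by (rule has_real_derivative_powr[OF that])
  \<comment> \<open>The coefficient of the source that subtracting
    \<open>p * x powr (p - 1) / \<theta>\<close> leaves in the equation for
    \<open>?w\<close>.\<close>
  define c where "c = - (p * (p - 1) / \<theta>)"
  txt \<open>\<open>u = x\<^sup>p - \<theta> k1\<close> solves \<open>u' = p x\<^bsup>p-1\<^esup> - \<theta> u\<close>; removing its leading term leaves \<open>w\<close>.\<close>
  let ?w = "\<lambda>x. x powr p - \<theta> * k1 x - p * x powr (p - 1) / \<theta>"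
  have w: "?w \<in> O(\<lambda>x. x powr (p - 2))"
  proof (rule linear_ode_bigo_powr[OF \<theta>])
    fix x :: real assume x: "x > 0"
    have "(?w has_real_derivative p * x powr (p - 1) - \<theta> * (x powr p - \<theta> * k1 x)
        - p * ((p - 1) * x powr (p - 1 - 1)) / \<theta>) (at x)"
      by (intro DERIV_diff DERIV_cmult DERIV_cdivide dpow k x)
    then show "(?w has_real_derivative c * x powr (p - 2) - \<theta> * ?w x) (at x)"
      by (rule DERIV_cong) (use \<theta> in \<open>simp add: c_def field_simps\<close>)
  next
    show "(\<lambda>x. c * x powr (p - 2)) \<in> O(\<lambda>x. x powr (p - 2))"
      by simp
  qed
  \<comment> \<open>The function \<open>- \<theta> * ?w x\<close> equals \<open>u'\<close>, and
    \<open>remainder_fn\<close> solves the damped equation with source \<open>u'\<close>.\<close>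
  have "(\<lambda>x. - \<theta> * ?w x) \<in> O(\<lambda>x. x powr (p - 2))"
    using w by simp
  then show ?thesis
  proof (rule linear_ode_bigo_powr[OF \<theta>, rotated])
    fix x :: real assume x: "x > 0"
    have "((\<lambda>x. x powr p - 2 * \<theta> * k1 x + \<theta>\<^sup>2 * k2 x) has_real_derivative
       p * x powr (p - 1) - 2 * \<theta> * (x powr p - \<theta> * k1 x) + \<theta>\<^sup>2 * (k1 x - \<theta> * k2 x)) (at x)"
      by (intro DERIV_diff DERIV_add DERIV_cmult dpow k x)
    then show "(remainder_fn \<theta> p has_real_derivative (- \<theta> * ?w x) - \<theta> * remainder_fn \<theta> p x) (at x)"
      unfolding v by (rule DERIV_cong) (use \<theta> in \<open>simp add: field_simps power2_eq_square\<close>)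
  qed
qed

text \<open>The difference is the tail of the Gamma integral. It is exponentially small, but only
  the order shared with the other terms is recorded.\<close>

lemma exp_powr_int_neg_bigo:
  assumes p: "p > 0" "p < 2"
  shows "(\<lambda>x. Gamma (p + 1) - exp_powr_int (-1) p x) \<in> O(\<lambda>x. x powr (p - 2))"
proof -
  let ?h = "\<lambda>w. exp (- 1 * w) * w powr p"
  have G: "(?h has_integral Gamma (p + 1)) {0..}"
    using Gamma_integral_real[of "p + 1"] p by (simp add: exp_minus field_simps)
  have abs: "?h absolutely_integrable_on {0..}"
    using G by (intro nonnegative_absolutely_integrable_1) (auto simp: has_integral_integrable)
  \<comment> \<open>The cube is chosen to bound the integrand by \<open>w powr (p - 3)\<close>,
    whose tail integral is exactly \<open>x powr (p - 2) / (2 - p)\<close>; it converges because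
    \<open>p < 2\<close>.\<close>
  have "((\<lambda>w::real. w ^ 3 * exp (- w)) \<longlongrightarrow> 0) at_top" by real_asymp
  then have "\<forall>\<^sub>F w in at_top. (w::real) ^ 3 * exp (- w) < 1"
    by (rule order_tendstoD) simp
  then obtain x0 where x0: "\<And>w::real. w \<ge> x0 \<Longrightarrow> w ^ 3 * exp (- w) < 1"
    by (auto simp: eventually_at_top_linorder)
  have "\<forall>\<^sub>F x in at_top. norm (Gamma (p + 1) - exp_powr_int (-1) p x) \<le> 1 / (2 - p) * norm (x powr (p - 2))"
    using eventually_ge_at_top[of x0] eventually_gt_at_top[of 0]
  proof eventually_elim
    case (elim x)
    have i1: "?h integrable_on {x..}"
      using set_integrable_subset[OF abs, of "{x..}"] elim by (intro set_lebesgue_integral_eq_integral(1)) auto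
    have i2: "?h integrable_on {0..x}"
      using set_integrable_subset[OF abs, of "{0..x}"] elim by (intro set_lebesgue_integral_eq_integral(1)) auto
    have "{0..x} \<inter> {x..} = {x}" "{0..x} \<union> {x..} = {0..}" using elim by auto
    then have "integral {0..} ?h = integral {0..x} ?h + integral {x..} ?h"
      using integral_Un[OF i2 i1] by simp
    then have tail: "Gamma (p + 1) - exp_powr_int (-1) p x = integral {x..} ?h"
      using integral_unique[OF G] by (simp add: exp_powr_int_def)
    have P: "((\<lambda>w. w powr (p - 3)) has_integral - (x powr (p - 3 + 1)) / (p - 3 + 1)) {x..}"
      by (rule has_integral_powr_to_inf) (use elim p in auto)
    have "integral {x..} ?h \<le> - (x powr (p - 3 + 1)) / (p - 3 + 1)"
    proof (rule has_integral_le[OF integrable_integral[OF i1] P])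
      fix w assume w: "w \<in> {x..}"
      then have "w ^ 3 * exp (- w) * w powr (p - 3) \<le> 1 * w powr (p - 3)"
        using x0[of w] elim by (intro mult_right_mono) auto
      moreover have "w ^ 3 * w powr (p - 3) = w powr p"
        using w elim by (simp add: powr_diff powr_numeral)
      ultimately show "?h w \<le> w powr (p - 3)" by (simp add: mult_ac)
    qed
    moreover have "- (x powr (p - 3 + 1)) / (p - 3 + 1) = 1 / (2 - p) * x powr (p - 2)"
      using minus_divide_divide[of "x powr (p - 2)" "p - 2"] by simp
    moreover have "integral {x..} ?h \<ge> 0"
      by (rule Henstock_Kurzweil_Integration.integral_nonneg[OF i1]) auto
    ultimately show ?case unfolding tail by simp
  qed
  then show ?thesis by (rule landau_o.bigI[rotated]) (use p in auto)
qed

text \<open>Reduction to unit rate, where the Gamma integral gives the limit.\<close>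

lemma exp_powr_int_scale:
  assumes p: "p > 0" and \<theta>: "\<theta> > 0" and x: "x \<ge> 0"
  shows "exp_powr_int (- \<theta>) p x = exp_powr_int (-1) p (\<theta> * x) / \<theta> powr (p + 1)"
proof -
  let ?G = "\<lambda>x. exp_powr_int (-1) p (\<theta> * x) / \<theta> powr (p + 1)"
  have "((\<lambda>w. exp (- \<theta> * w) * w powr p) has_integral ?G x - ?G 0) {0..x}"
  proof (rule fundamental_theorem_of_calculus_interior_real)
    show "continuous_on {0..x} ?G"
      by (intro continuous_intros continuous_exp_powr_int_compose[OF p]) (use assms in auto)
    fix w assume w: "0 < w" "w < x"
    show "(?G has_real_derivative exp (- \<theta> * w) * w powr p) (at w)"
    proof -
      have "(?G has_real_derivative exp (- 1 * (\<theta> * w)) * (\<theta> * w) powr p * \<theta> / \<theta> powr (p + 1)) (at w)"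
        using w p \<theta>
        by (intro DERIV_cdivide DERIV_chain2[OF DERIV_exp_powr_int(1)]) (auto intro!: derivative_eq_intros)
      then show ?thesis
        by (rule DERIV_cong) (use w \<theta> in \<open>simp add: powr_mult powr_add\<close>)
    qed
  qed fact
  from integral_unique[OF this] show ?thesis by (simp add: exp_powr_int_def)
qed

lemma sub_fOU_moment_bigo:
  assumes p: "p > 0" "p < 2" and \<theta>: "\<theta> > 0"
  shows "(\<lambda>t. sub_fOU_moment \<theta> p t - p / 2 * Gamma p / \<theta> powr p) \<in> O(\<lambda>t. t powr (p - 2))"
proof -
  let ?k1 = "\<lambda>x. exp (- \<theta> * x) * exp_powr_int \<theta> p x"
  let ?k2 = "\<lambda>x. exp (- \<theta> * x) * exp_powr_int2 \<theta> p x"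
  have scale: "(\<lambda>t. (c * t) powr (p - 2)) \<in> O(\<lambda>t. t powr (p - 2))" if "c > 0" for c :: real
  proof -
    have "\<forall>\<^sub>F t in at_top. (c * t) powr (p - 2) = c powr (p - 2) * t powr (p - 2)"
      using eventually_gt_at_top[of 0] by eventually_elim (use that in \<open>simp add: powr_mult\<close>)
    from landau_o.big.in_cong[OF this] show ?thesis by simp
  qed
  have top: "filterlim (\<lambda>t. c * t) at_top at_top" if "c > 0" for c :: real
    using that by (intro filterlim_tendsto_pos_mult_at_top[OF tendsto_const _ filterlim_ident])
  have 1: "(\<lambda>t. remainder_fn \<theta> p (2 * t)) \<in> O(\<lambda>t. t powr (p - 2))"
    using landau_o.big.trans[OF landau_o.big.compose[OF remainder_fn_bigo[OF p(1) \<theta>] top[of 2]] scale[of 2]] by simp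
  have 2: "(\<lambda>t. Gamma (p + 1) - exp_powr_int (-1) p (\<theta> * t)) \<in> O(\<lambda>t. t powr (p - 2))"
    using landau_o.big.trans[OF landau_o.big.compose[OF exp_powr_int_neg_bigo[OF p] top[OF \<theta>]] scale[OF \<theta>]] by simp
  have 3: "(\<lambda>t. t powr p * exp (- \<theta> * t)) \<in> O(\<lambda>t. t powr (p - 2))"
    using \<theta> by real_asymp
  have 4: "(\<lambda>t. exp (- \<theta> * t) * ?k1 t) \<in> O(\<lambda>t. t powr (p - 2))"
    using landau_o.big.trans[OF landau_o.big.mult[OF landau_o.big_refl exp_powr_int_bigo(1)[OF p(1) \<theta>]]] 3
    by (simp add: mult.commute)
  have 5: "(\<lambda>t. exp (- \<theta> * t) * ?k2 t) \<in> O(\<lambda>t. t powr (p - 2))"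
    using landau_o.big.trans[OF landau_o.big.mult[OF landau_o.big_refl exp_powr_int_bigo(2)[OF p(1) \<theta>]]] 3
    by (simp add: mult.commute)
  \<comment> \<open>The limit is split off from
    \<open>\<theta> / 2 * exp_powr_int (- \<theta>) p t\<close>: after rescaling its coefficient is
    \<open>\<theta> / 2 / \<theta> powr (p + 1) = 1 / (2 * \<theta> powr p)\<close>, and
    \<open>Gamma (p + 1) = p * Gamma p\<close>.\<close>
  have "\<forall>\<^sub>F t in at_top. sub_fOU_moment \<theta> p t - p / 2 * Gamma p / \<theta> powr p =
     - 1 / 2 * remainder_fn \<theta> p (2 * t)
     - 1 / (2 * \<theta> powr p) * (Gamma (p + 1) - exp_powr_int (-1) p (\<theta> * t))
     + 2 * (t powr p * exp (- \<theta> * t))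
     + \<theta>\<^sup>2 * (exp (- \<theta> * t) * ?k2 t) - 5 / 2 * \<theta> * (exp (- \<theta> * t) * ?k1 t)"
    using eventually_ge_at_top[of 0]
  proof eventually_elim
    case (elim t)
    have e: "exp (- 2 * \<theta> * t) = exp (- \<theta> * t) * exp (- \<theta> * t)" by (simp flip: exp_add)
    have g: "Gamma (p + 1) = p * Gamma p" using p(1) by (metis Gamma_plus1 nonpos_Ints_nonpos not_le)
    show ?case
      unfolding sub_fOU_moment_eq[OF p(1) \<theta> elim] exp_powr_int_scale[OF p(1) \<theta> elim] e g
      using \<theta> by (simp add: powr_add field_simps)
  qed
  note eq = landau_o.big.in_cong[OF this]
  have cmult: "(\<lambda>t. c * f t) \<in> O(\<lambda>t. t powr (p - 2))"
    if "f \<in> O(\<lambda>t. t powr (p - 2))" for c and f :: "real \<Rightarrow> real"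
    using that by simp
  show ?thesis
    unfolding eq by (intro sum_in_bigo cmult 1 2 3 4 5)
qed

section \<open>Second moment of the explicit solution\<close>

text \<open>The Bochner integral of a non-integrable function is 0 by convention, so the covariance
  identity by itself does not provide integrability; the Gaussian law does.\<close>

lemma (in prob_space) gaussian_square_integrable:
  assumes "random_variable borel Y"
    and "distr M borel Y = distr std_normal_distribution borel (\<lambda>z. \<mu> + \<sigma> * z)"
  shows "integrable M (\<lambda>\<omega>. (Y \<omega>)\<^sup>2)"
proof -
  have "integrable std_normal_distribution (\<lambda>z. z ^ k)" for k :: nat
    by (subst integrable_density) (auto intro!: integrable_std_normal_moment)
  from this[of 2] this[of 1]
  have "integrable std_normal_distribution (\<lambda>z. \<mu>\<^sup>2 + 2 * \<mu> * \<sigma> * z + \<sigma>\<^sup>2 * z\<^sup>2)"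
    using prob_space.finite_measure[OF prob_space_normal_density[of 1 0]]
    by (auto intro!: Bochner_Integration.integrable_add integrable_mult_right finite_measure.integrable_const)
  then have "integrable (distr std_normal_distribution borel (\<lambda>z. \<mu> + \<sigma> * z)) (\<lambda>y. y\<^sup>2)"
    by (subst integrable_distr_eq) (auto simp: power2_sum power_mult_distrib algebra_simps)
  then have "integrable (distr M borel Y) (\<lambda>y. y\<^sup>2)" using assms(2) by simp
  then show ?thesis using assms(1) by (subst (asm) integrable_distr_eq) auto
qed

text \<open>Stated for a process \<open>T\<close> on the whole real line with every path continuous,
  the setting in which the Fubini lemma applies. That lemma is used for
  \<open>E[T\<^sub>u J\<^sub>u]\<close> first and then for
  \<open>E[J\<^sub>t\<^sup>2]\<close>.\<close>

lemma (in prob_space) ou_second_moment: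
  fixes T :: "real \<Rightarrow> 'a \<Rightarrow> real"
  assumes p: "p > 0" and \<theta>: "\<theta> > 0"
    and meas [measurable]: "\<And>u. T u \<in> borel_measurable M"
    and cont: "\<And>\<omega>. \<omega> \<in> space M \<Longrightarrow> continuous_on UNIV (\<lambda>u. T u \<omega>)"
    and sq: "\<And>u. integrable M (\<lambda>\<omega>. (T u \<omega>)\<^sup>2)"
    and cov: "\<And>u r. u \<ge> 0 \<Longrightarrow> r \<ge> 0 \<Longrightarrow> expectation (\<lambda>\<omega>. T u \<omega> * T r \<omega>) = sfbm_cov p u r"
    and t: "t \<ge> 0"
  shows "integrable M (\<lambda>\<omega>. (T t \<omega> - \<theta> * exp (- \<theta> * t) * integral {0..t} (\<lambda>r. exp (\<theta> * r) * T r \<omega>))\<^sup>2)"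
    and "expectation (\<lambda>\<omega>. (T t \<omega> - \<theta> * exp (- \<theta> * t) * integral {0..t} (\<lambda>r. exp (\<theta> * r) * T r \<omega>))\<^sup>2)
           = sub_fOU_moment \<theta> p t"
proof -
  define J where "J u \<omega> = integral {0..u} (\<lambda>r. exp (\<theta> * r) * T r \<omega>)" for u \<omega>
  have int: "integrable M (\<lambda>\<omega>. T u \<omega> * T r \<omega>)" for u r
  proof (rule Bochner_Integration.integrable_bound[OF Bochner_Integration.integrable_add[OF sq[of u] sq[of r]]])
    have "\<bar>a * b\<bar> \<le> a\<^sup>2 + b\<^sup>2" for a b :: real
      using sum_squares_bound[of "\<bar>a\<bar>" "\<bar>b\<bar>"] abs_ge_zero[of "a * b"] unfolding abs_mult power2_abs by linarith
    then show "AE \<omega> in M. norm (T u \<omega> * T r \<omega>) \<le> norm ((T u \<omega>)\<^sup>2 + (T r \<omega>)\<^sup>2)"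
      by simp
  qed simp
  obtain B where B: "\<And>u. 0 \<le> u \<Longrightarrow> u \<le> t \<Longrightarrow> sfbm_cov p u u \<le> B"
  proof -
    have "continuous_on {0..t} (\<lambda>u. 2 * u powr p - 1 / 2 * (2 * u) powr p)"
      by (intro continuous_intros continuous_exp_powr_int_compose[OF p]) auto
    from compact_imp_bounded[OF compact_continuous_image[OF this]]
    obtain B where "\<And>u. u \<in> {0..t} \<Longrightarrow> \<bar>2 * u powr p - 1 / 2 * (2 * u) powr p\<bar> \<le> B"
      unfolding bounded_iff by fastforce
    then show ?thesis by (intro that[of B]) (force simp: sfbm_cov_def abs_le_iff)
  qed
  \<comment> \<open>The arithmetic-geometric mean inequality reduces the mixed absolute moment to
    two variances, both bounded by \<open>B\<close> on the compact interval.\<close>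
  have absbound: "expectation (\<lambda>\<omega>. \<bar>T u \<omega> * T r \<omega>\<bar>) \<le> B" if "0 \<le> u" "u \<le> t" "0 \<le> r" "r \<le> t" for u r
  proof -
    have "expectation (\<lambda>\<omega>. \<bar>T u \<omega> * T r \<omega>\<bar>) \<le> expectation (\<lambda>\<omega>. ((T u \<omega>)\<^sup>2 + (T r \<omega>)\<^sup>2) / 2)"
    proof (rule integral_mono)
      fix \<omega>
      have "2 * \<bar>T u \<omega>\<bar> * \<bar>T r \<omega>\<bar> \<le> (T u \<omega>)\<^sup>2 + (T r \<omega>)\<^sup>2"
        using sum_squares_bound[of "\<bar>T u \<omega>\<bar>" "\<bar>T r \<omega>\<bar>"] by simp
      then show "\<bar>T u \<omega> * T r \<omega>\<bar> \<le> ((T u \<omega>)\<^sup>2 + (T r \<omega>)\<^sup>2) / 2" by (simp add: abs_mult)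
    qed (use int sq in auto)
    also have "\<dots> = (sfbm_cov p u u + sfbm_cov p r r) / 2"
      using sq cov[of u u] cov[of r r] that by (simp add: power2_eq_square)
    also have "\<dots> \<le> B" using B[of u] B[of r] that by simp
    finally show ?thesis .
  qed
  have B0: "B \<ge> 0"
  proof -
    have "0 \<le> expectation (\<lambda>\<omega>. \<bar>T 0 \<omega> * T 0 \<omega>\<bar>)"
      by (rule Bochner_Integration.integral_nonneg) simp
    also have "\<dots> \<le> B" using absbound[of 0 0] t by simp
    finally show ?thesis .
  qed
  have contJ: "continuous_on UNIV (\<lambda>u. J (max 0 u) \<omega>)" if "\<omega> \<in> space M" for \<omega>
  proof -
    have "continuous_on {0..} (\<lambda>u. J u \<omega>)"
      unfolding J_def using cont[OF that]
      by (intro continuous_on_integral_atLeast continuous_intros) (auto intro: continuous_on_subset)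
    then show ?thesis by (rule continuous_on_compose2) (auto intro!: continuous_intros)
  qed
  \<comment> \<open>The third claim supplies the uniform bound on absolute moments that the second
    use of Fubini requires.\<close>
  have first: "integrable M (\<lambda>\<omega>. T u \<omega> * J u \<omega>)" (is ?A)
      "expectation (\<lambda>\<omega>. T u \<omega> * J u \<omega>) = sfbm_cov_int \<theta> p u" (is ?B)
      "expectation (\<lambda>\<omega>. \<bar>T u \<omega> * J u \<omega>\<bar>) \<le> t * (exp (\<theta> * t) * B)" (is ?C) if u: "0 \<le> u" "u \<le> t" for u
  proof -
    define Y where "Y r \<omega> = exp (\<theta> * r) * (T u \<omega> * T r \<omega>)" for r \<omega>
    have Y: "Y r \<in> borel_measurable M" "integrable M (Y r)" for r
      unfolding Y_def using int by auto
    have contY: "continuous_on UNIV (\<lambda>r. Y r \<omega>)" if "\<omega> \<in> space M" for \<omega>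
      unfolding Y_def by (intro continuous_intros cont that)
    have bY: "expectation (\<lambda>\<omega>. \<bar>Y r \<omega>\<bar>) \<le> exp (\<theta> * t) * B" if "r \<in> {0..u}" for r
    proof -
      have "expectation (\<lambda>\<omega>. \<bar>Y r \<omega>\<bar>) = exp (\<theta> * r) * expectation (\<lambda>\<omega>. \<bar>T u \<omega> * T r \<omega>\<bar>)"
        by (simp add: Y_def abs_mult)
      also have "\<dots> \<le> exp (\<theta> * t) * B"
        using that u \<theta> by (intro mult_mono absbound) auto
      finally show ?thesis .
    qed
    have TJ: "T u \<omega> * J u \<omega> = integral {0..u} (\<lambda>r. Y r \<omega>)" for \<omega>
      by (simp add: Y_def J_def mult.left_commute flip: integral_mult_right)
    note E = expectation_integral_continuous_process[of Y, OF Y(1) contY Y(2) bY]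
    show ?A unfolding TJ by (rule E(1))
    have "expectation (\<lambda>\<omega>. T u \<omega> * J u \<omega>) = integral {0..u} (\<lambda>r. expectation (Y r))"
      unfolding TJ by (rule E(2))
    also have "\<dots> = integral {0..u} (\<lambda>r. exp (\<theta> * r) * sfbm_cov p u r)"
      using cov[of u] u by (intro Henstock_Kurzweil_Integration.integral_cong) (simp add: Y_def[abs_def])
    finally show ?B using integral_sfbm_cov[OF p \<theta> u(1)] by simp
    have aY: "(\<lambda>\<omega>. \<bar>Y r \<omega>\<bar>) \<in> borel_measurable M" "integrable M (\<lambda>\<omega>. \<bar>Y r \<omega>\<bar>)" for r
      using Y[of r] by auto
    have contaY: "continuous_on UNIV (\<lambda>r. \<bar>Y r \<omega>\<bar>)" if "\<omega> \<in> space M" for \<omega>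
      by (intro continuous_intros contY that)
    note E' = expectation_integral_continuous_process[of "\<lambda>r \<omega>. \<bar>Y r \<omega>\<bar>", OF aY(1) contaY aY(2), of u "exp (\<theta> * t) * B"]
    have "expectation (\<lambda>\<omega>. \<bar>T u \<omega> * J u \<omega>\<bar>) \<le> expectation (\<lambda>\<omega>. integral {0..u} (\<lambda>r. \<bar>Y r \<omega>\<bar>))"
    proof (rule integral_mono)
      show "integrable M (\<lambda>\<omega>. \<bar>T u \<omega> * J u \<omega>\<bar>)" using \<open>?A\<close> by simp
      show "integrable M (\<lambda>\<omega>. integral {0..u} (\<lambda>r. \<bar>Y r \<omega>\<bar>))" by (rule E'(1)) (use bY in auto)
      fix \<omega> assume w: "\<omega> \<in> space M"
      show "\<bar>T u \<omega> * J u \<omega>\<bar> \<le> integral {0..u} (\<lambda>r. \<bar>Y r \<omega>\<bar>)"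
        unfolding TJ real_norm_def[symmetric]
        by (rule integral_norm_bound_integral)
           (auto intro!: integrable_continuous_real continuous_on_subset[OF contY[OF w]]
               continuous_on_subset[OF contaY[OF w], simplified])
    qed
    also have "\<dots> = integral {0..u} (\<lambda>r. expectation (\<lambda>\<omega>. \<bar>Y r \<omega>\<bar>))"
      by (rule E'(2)) (use bY in auto)
    also have "\<dots> \<le> u * (exp (\<theta> * t) * B)"
    \<comment> \<open>Integrability in \<open>r\<close> need not be established here: otherwise the
      gauge integral is 0 by convention and the bound is trivial.\<close>
    proof (cases "(\<lambda>r. expectation (\<lambda>\<omega>. \<bar>Y r \<omega>\<bar>)) integrable_on {0..u}")
      case True
      have "integral {0..u} (\<lambda>r. expectation (\<lambda>\<omega>. \<bar>Y r \<omega>\<bar>)) \<le> integral {0..u} (\<lambda>r. exp (\<theta> * t) * B)"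
        by (rule integral_le[OF True]) (use bY in auto)
      then show ?thesis using u by (simp add: mult_ac)
    next
      case False
      then show ?thesis using u B0 by (simp add: not_integrable_integral)
    qed
    also have "\<dots> \<le> t * (exp (\<theta> * t) * B)" using u B0 by (intro mult_right_mono) auto
    finally show ?C .
  qed
  have J0: "J 0 \<omega> = 0" for \<omega> by (simp add: J_def)
  \<comment> \<open>\<open>J\<close> is defined path by path; as a Lebesgue integral with parameter
    it is measurable in \<open>\<omega>\<close>.\<close>
  have mJ: "(\<lambda>\<omega>. J u \<omega>) \<in> borel_measurable M" if "u \<ge> 0" for u
  proof -
    have "(\<lambda>(r, \<omega>). T r \<omega>) \<in> borel_measurable (borel \<Otimes>\<^sub>M M)"
      by (subst measurable_cong_sets[OF sets_pair_measure_cong[OF sets_lborel refl] refl, symmetric])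
         (rule borel_measurable_continuous_process[OF meas cont])
    from measurable_compose[OF measurable_pair_swap' this]
    have m: "(\<lambda>z. T (snd z) (fst z)) \<in> borel_measurable (M \<Otimes>\<^sub>M borel)"
      by (simp add: case_prod_beta')
    have "(\<lambda>\<omega>. \<integral>r. indicator {0..u} r * (exp (\<theta> * r) * T r \<omega>) \<partial>lborel) \<in> borel_measurable M"
      using m by measurable
    moreover have "J u \<omega> = (\<integral>r. indicator {0..u} r * (exp (\<theta> * r) * T r \<omega>) \<partial>lborel)" if "\<omega> \<in> space M" for \<omega>
    proof -
      have "set_integrable lborel {0..u} (\<lambda>r. exp (\<theta> * r) * T r \<omega>)"
        using continuous_on_subset[OF cont[OF that], of "{0..u}"]
        by (intro borel_integrable_atLeastAtMost' continuous_intros) auto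
      from set_borel_integral_eq_integral(2)[OF this] show ?thesis
        by (simp add: set_lebesgue_integral_def J_def)
    qed
    ultimately show ?thesis by (simp cong: measurable_cong)
  qed
  \<comment> \<open>The truncation \<open>max 0 u\<close> extends the integrand to negative times,
    as the Fubini lemma asks for measurability and continuity at all real times.\<close>
  define Y where "Y u \<omega> = 2 * exp (\<theta> * max 0 u) * (T (max 0 u) \<omega> * J (max 0 u) \<omega>)" for u \<omega>
  have sqJ: "(J t \<omega>)\<^sup>2 = integral {0..t} (\<lambda>u. Y u \<omega>)" if "\<omega> \<in> space M" for \<omega>
  proof -
    have h: "continuous_on {0..} (\<lambda>r. exp (\<theta> * r) * T r \<omega>)"
      using cont[OF that] by (intro continuous_intros) (auto intro: continuous_on_subset)
    have "((\<lambda>u. Y u \<omega>) has_integral (J t \<omega>)\<^sup>2 - (J 0 \<omega>)\<^sup>2) {0..t}"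
    proof (rule fundamental_theorem_of_calculus_interior_real[OF t])
      show "continuous_on {0..t} (\<lambda>u. (J u \<omega>)\<^sup>2)"
        unfolding J_def using continuous_on_integral_atLeast[OF h]
        by (intro continuous_intros) (auto intro: continuous_on_subset)
      fix u assume u: "0 < u" "u < t"
      have "((\<lambda>u. J u \<omega>) has_real_derivative exp (\<theta> * u) * T u \<omega>) (at u)"
        unfolding J_def by (rule integral_has_real_derivative_atLeast[OF h u(1)])
      from DERIV_power[OF this, of 2]
      show "((\<lambda>u. (J u \<omega>)\<^sup>2) has_real_derivative Y u \<omega>) (at u)"
        using u by (simp add: Y_def mult_ac)
    qed
    then show ?thesis by (simp add: J0 integral_unique)
  qed
  have Y1: "Y u \<in> borel_measurable M" for u
    unfolding Y_def using mJ[of "max 0 u"] by measurable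
  have Y2: "continuous_on UNIV (\<lambda>u. Y u \<omega>)" if "\<omega> \<in> space M" for \<omega>
    unfolding Y_def
    by (intro continuous_intros contJ that continuous_on_compose2[OF cont[OF that]]) auto
  have Y3: "integrable M (Y u)" if "u \<in> {0..t}" for u
    using first(1)[of u] that unfolding Y_def by simp
  have Y4: "expectation (\<lambda>\<omega>. \<bar>Y u \<omega>\<bar>) \<le> 2 * exp (\<theta> * t) * (t * (exp (\<theta> * t) * B))" if "u \<in> {0..t}" for u
  proof -
    have "expectation (\<lambda>\<omega>. \<bar>Y u \<omega>\<bar>) = 2 * exp (\<theta> * u) * expectation (\<lambda>\<omega>. \<bar>T u \<omega> * J u \<omega>\<bar>)"
      using that by (simp add: Y_def abs_mult)
    also have "\<dots> \<le> 2 * exp (\<theta> * t) * (t * (exp (\<theta> * t) * B))"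
      using that \<theta> first(3)[of u] by (intro mult_mono) auto
    finally show ?thesis .
  qed
  note E = expectation_integral_continuous_process[of Y, OF Y1 Y2 Y3 Y4]
  have sqJ_int: "integrable M (\<lambda>\<omega>. (J t \<omega>)\<^sup>2)"
    using E(1) by (subst Bochner_Integration.integrable_cong[OF refl sqJ]) auto
  have "expectation (\<lambda>\<omega>. (J t \<omega>)\<^sup>2) = integral {0..t} (\<lambda>u. expectation (Y u))"
    using E(2) by (subst Bochner_Integration.integral_cong[OF refl sqJ]) auto
  also have "\<dots> = integral {0..t} (\<lambda>u. 2 * exp (\<theta> * u) * sfbm_cov_int \<theta> p u)"
    using first(2) by (intro Henstock_Kurzweil_Integration.integral_cong) (simp add: Y_def[abs_def])
  also have "\<dots> = weighted_moment \<theta> p t"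
    by (rule integral_sfbm_cov_int[OF p \<theta> t])
  finally have EJ: "expectation (\<lambda>\<omega>. (J t \<omega>)\<^sup>2) = weighted_moment \<theta> p t" .
  have square: "(T t \<omega> - \<theta> * exp (- \<theta> * t) * J t \<omega>)\<^sup>2 =
     (T t \<omega>)\<^sup>2 - 2 * \<theta> * exp (- \<theta> * t) * (T t \<omega> * J t \<omega>) + \<theta>\<^sup>2 * exp (- 2 * \<theta> * t) * (J t \<omega>)\<^sup>2" for \<omega>
  proof -
    have "exp (- 2 * \<theta> * t) = (exp (- \<theta> * t))\<^sup>2" by (simp add: power2_eq_square flip: exp_add)
    then show ?thesis by (simp add: power2_diff power_mult_distrib)
  qed
  show "integrable M (\<lambda>\<omega>. (T t \<omega> - \<theta> * exp (- \<theta> * t) * integral {0..t} (\<lambda>r. exp (\<theta> * r) * T r \<omega>))\<^sup>2)"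
    unfolding J_def[symmetric] square using sq[of t] sqJ_int first(1)[of t] t by simp
  show "expectation (\<lambda>\<omega>. (T t \<omega> - \<theta> * exp (- \<theta> * t) * integral {0..t} (\<lambda>r. exp (\<theta> * r) * T r \<omega>))\<^sup>2)
           = sub_fOU_moment \<theta> p t"
    unfolding J_def[symmetric] square sub_fOU_moment_def
    using sq[of t] sqJ_int first(1,2)[of t] EJ cov[of t t] t by (simp add: power2_eq_square)
qed

section \<open>Bounds for all times and rates of the sums\<close>

text \<open>Beyond some \<open>t1\<close> the asymptotic estimate applies. On the compact interval
  up to \<open>t1\<close> the difference is bounded by continuity, while
  \<open>t powr (p - 2)\<close> is at least its value at \<open>t1\<close>, the exponent being
  negative.\<close>

lemma sub_fOU_moment_bound:
  assumes p: "p > 0" "p < 2" and \<theta>: "\<theta> > 0"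
  shows "\<exists>C>0. \<forall>t>0. \<bar>sub_fOU_moment \<theta> p t - p / 2 * Gamma p / \<theta> powr p\<bar> \<le> C * t powr (p - 2)"
proof -
  let ?d = "\<lambda>t. sub_fOU_moment \<theta> p t - p / 2 * Gamma p / \<theta> powr p"
  obtain A where A: "A > 0" "\<forall>\<^sub>F t in at_top. norm (?d t) \<le> A * norm (t powr (p - 2))"
    using sub_fOU_moment_bigo[OF assms] by (elim landau_o.bigE)
  then obtain t0 where t0: "\<And>t. t \<ge> t0 \<Longrightarrow> \<bar>?d t\<bar> \<le> A * t powr (p - 2)"
    by (auto simp: eventually_at_top_linorder)
  define t1 where "t1 = max 1 t0"
  have t1: "t1 > 0" "t1 \<ge> t0" by (auto simp: t1_def)
  have "continuous_on {0..t1} ?d"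
    by (intro continuous_intros continuous_on_subset[OF continuous_on_sub_fOU_moment[OF p(1) \<theta>]]) auto
  from compact_imp_bounded[OF compact_continuous_image[OF this]]
  obtain B where B: "\<And>t. t \<in> {0..t1} \<Longrightarrow> \<bar>?d t\<bar> \<le> B"
    unfolding bounded_iff by fastforce
  have B0: "B \<ge> 0" using B[of 0] t1 by auto
  define C where "C = max A (B / t1 powr (p - 2))"
  have "C > 0" using A(1) by (simp add: C_def)
  moreover have "\<bar>?d t\<bar> \<le> C * t powr (p - 2)" if t: "t > 0" for t
  proof (cases "t \<le> t1")
    case True
    have "\<bar>?d t\<bar> \<le> B / t1 powr (p - 2) * t1 powr (p - 2)" using B[of t] True t t1 by simp
    also have "\<dots> \<le> C * t powr (p - 2)"
      using True t t1 p B0 A(1) by (intro mult_mono powr_mono2') (auto simp: C_def)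
    finally show ?thesis .
  next
    case False
    have "\<bar>?d t\<bar> \<le> A * t powr (p - 2)" using False t1 by (intro t0) auto
    also have "\<dots> \<le> C * t powr (p - 2)" by (intro mult_right_mono) (auto simp: C_def)
    finally show ?thesis .
  qed
  ultimately show ?thesis by blast
qed

text \<open>Each increment of \<open>ln\<close> dominates the next reciprocal, by
  \<open>ln x \<le> x - 1\<close> at \<open>x = n / (n + 1)\<close>.\<close>

lemma harm_le_ln:
  assumes "n \<ge> 1"
  shows "harm n \<le> ln (real n) + 1"
  using assms
proof (induction n rule: nat_induct_at_least)
  case (Suc n)
  have "ln (real n / real (Suc n)) \<le> real n / real (Suc n) - 1"
    using Suc by (intro ln_le_minus_one) auto
  also have "real n / real (Suc n) - 1 = - inverse (real (Suc n))"
    by (simp add: field_simps)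
  finally have "inverse (real (Suc n)) \<le> ln (real (Suc n)) - ln (real n)"
    using Suc by (subst (asm) ln_div) auto
  with Suc show ?case by (simp add: harm_Suc)
qed (simp add: harm_def)

text \<open>The exponent \<open>2 * H - 2\<close> passes -1 at \<open>H = 1 / 2\<close>: the series
  converges below, is harmonic there, and its partial sums grow like a power above.\<close>

lemma sum_powr_rate:
  fixes H :: real
  assumes "H < 1"
  shows "\<exists>K>0. \<forall>n>1. (\<Sum>i=1..n. real i powr (2 * H - 2)) / sqrt (real n) \<le>
    K * (if H < 1 / 2 then real n powr (- 1 / 2)
         else if H = 1 / 2 then real n powr (- 1 / 2) * ln (real n)
         else real n powr (2 * H - 3 / 2))"
proof -
  have sqrt: "1 / sqrt (real n) = real n powr (- 1 / 2)" for n
    using powr_minus_divide[of "real n" "1 / 2"] by (simp add: powr_half_sqrt)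
  consider "H < 1 / 2" | "H = 1 / 2" | "H > 1 / 2" by linarith
  then show ?thesis
  proof cases
    case 1
    then obtain C where C: "\<And>n. (\<Sum>i=1..n. real i powr (2 * H - 2)) \<le> C" "C > 0"
      using summable_sum_powr_bound[of "2 * H - 2"] by auto
    have "(\<Sum>i=1..n. real i powr (2 * H - 2)) / sqrt (real n) \<le> C * real n powr (- 1 / 2)" for n
      using mult_right_mono[OF C(1), of "1 / sqrt (real n)" n] unfolding sqrt[symmetric] by simp
    then show ?thesis using 1 C(2) by (intro exI[of _ C]) auto
  next
    case 2
    \<comment> \<open>For \<open>n \<ge> 2\<close> the additive 1 in the harmonic bound is at most
      \<open>ln n / ln 2\<close>, which explains the constant.\<close>
    have "(\<Sum>i=1..n. real i powr (2 * H - 2)) / sqrt (real n) \<le>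
        (1 + 1 / ln 2) * (real n powr (- 1 / 2) * ln (real n))" if n: "n > 1" for n :: nat
    proof -
      have "(\<Sum>i=1..n. real i powr (2 * H - 2)) = harm n"
      proof -
        have "2 * H - 2 = - 1" using 2 by simp
        then show ?thesis unfolding harm_def by (intro sum.cong) (simp_all add: powr_minus)
      qed
      also have "\<dots> \<le> ln (real n) + 1" using harm_le_ln[of n] n by simp
      also have "\<dots> \<le> (1 + 1 / ln 2) * ln (real n)"
        using n by (simp add: field_simps)
      finally have "(\<Sum>i=1..n. real i powr (2 * H - 2)) * (1 / sqrt (real n)) \<le>
        (1 + 1 / ln 2) * ln (real n) * (1 / sqrt (real n))"
        by (rule mult_right_mono) auto
      then show ?thesis unfolding sqrt[symmetric] by (simp add: mult_ac)
    qed
    moreover have "1 + 1 / ln 2 > (0::real)" by (simp add: add_pos_pos)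
    ultimately show ?thesis using 2
      by (intro exI[of _ "1 + 1 / ln 2"]) (simp only: less_irrefl if_False if_True simp_thms, blast)
  next
    case 3
    have "(\<Sum>i=1..n. real i powr (2 * H - 2)) / sqrt (real n) \<le>
        1 / (2 * H - 1) * real n powr (2 * H - 3 / 2)" if n: "n > 1" for n :: nat
    proof -
      have "(\<Sum>i=1..n. real i powr (2 * H - 2)) \<le> real n powr (2 * H - 2 + 1) / (2 * H - 2 + 1)"
        using 3 assms by (intro sum_powr_le_neg) auto
      then have "(\<Sum>i=1..n. real i powr (2 * H - 2)) * (1 / sqrt (real n)) \<le>
        real n powr (2 * H - 2 + 1) / (2 * H - 2 + 1) * (1 / sqrt (real n))"
        by (rule mult_right_mono) auto
      also have "\<dots> = 1 / (2 * H - 1) * (real n powr (2 * H - 1) * real n powr (- 1 / 2))"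
        unfolding sqrt by simp
      also have "real n powr (2 * H - 1) * real n powr (- 1 / 2) = real n powr (2 * H - 3 / 2)"
        by (simp flip: powr_add)
      finally show ?thesis by simp
    qed
    moreover have "1 / (2 * H - 1) > 0" using 3 by simp
    ultimately show ?thesis using 3 by (intro exI[of _ "1 / (2 * H - 1)"]) auto
  qed
qed

section \<open>Transfer to the given process\<close>

text \<open>The hypotheses hold almost surely and on the half-line, whereas
  \<open>ou_second_moment\<close> asks for them everywhere. A modification \<open>T\<close> of
  \<open>S\<close> bridges the gap, and off a null set \<open>X\<close> is the explicit solution
  driven by \<open>T\<close>.\<close>

lemma sub_fractional_OU_second_moment:
  assumes H: "0 < H" and \<theta>: "\<theta> > 0"
    and S: "sub_fractional_BM M H S" and X: "sub_fractional_OU M \<theta> S X" and t: "t \<ge> 0"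
  shows "(\<integral>\<omega>. (X t \<omega>)\<^sup>2 \<partial>M) = sub_fOU_moment \<theta> (2 * H) t"
proof -
  have G: "gaussian_process M {0..} S" and cS: "AE \<omega> in M. continuous_on {0..} (\<lambda>t. S t \<omega>)"
    and cov: "\<And>t s. t \<ge> 0 \<Longrightarrow> s \<ge> 0 \<Longrightarrow> (\<integral>\<omega>. S t \<omega> * S s \<omega> \<partial>M) = sfbm_cov (2 * H) t s"
    using S unfolding sub_fractional_BM_def sfbm_cov_def by auto
  interpret prob_space M using G by (simp add: gaussian_process_def)
  have mS: "S u \<in> borel_measurable M" if "u \<ge> 0" for u
    using G that by (simp add: gaussian_process_def)
  have sqS: "integrable M (\<lambda>\<omega>. (S u \<omega>)\<^sup>2)" if u: "u \<ge> 0" for u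
  proof -
    have "\<exists>\<mu> \<sigma>. distr M borel (\<lambda>\<omega>. \<Sum>t\<in>{u}. 1 * S t \<omega>) = distr std_normal_distribution borel (\<lambda>z. \<mu> + \<sigma> * z)"
      using G u unfolding gaussian_process_def by (elim conjE allE[of _ "{u}"] allE[of _ "\<lambda>_. 1"]) auto
    then show ?thesis using gaussian_square_integrable[OF mS[OF u]] by auto
  qed
  \<comment> \<open>The variance at time 0 vanishes, which yields the start at 0 that
    \<open>langevin_solution_iff\<close> assumes.\<close>
  have "(\<integral>\<omega>. (S 0 \<omega>)\<^sup>2 \<partial>M) = 0"
    using cov[of 0 0] by (simp add: power2_eq_square sfbm_cov_def)
  then have S0: "AE \<omega> in M. S 0 \<omega> = 0"
    using integral_nonneg_eq_0_iff_AE[OF sqS[of 0]] by auto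
  have "AE \<omega> in M. continuous_on {0..} (\<lambda>t. S t \<omega>) \<and> S 0 \<omega> = 0 \<and> langevin_solution \<theta> (\<lambda>t. S t \<omega>) (\<lambda>t. X t \<omega>)"
    using cS S0 X unfolding sub_fractional_OU_def by auto
  then obtain N where N: "{\<omega> \<in> space M. \<not> (continuous_on {0..} (\<lambda>t. S t \<omega>) \<and> S 0 \<omega> = 0 \<and>
      langevin_solution \<theta> (\<lambda>t. S t \<omega>) (\<lambda>t. X t \<omega>))} \<subseteq> N" "emeasure M N = 0" "N \<in> sets M"
    by (rule AE_E)
  \<comment> \<open>Paths in the exceptional set become zero, and every other path is frozen at its
    initial value for negative times.\<close>
  define T where "T u \<omega> = indicat_real (- N) \<omega> * S (max 0 u) \<omega>" for u \<omega>
  have aeN: "AE \<omega> in M. \<omega> \<notin> N"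
    using N by (intro AE_not_in) (auto simp: null_sets_def)
  have good: "continuous_on {0..} (\<lambda>t. S t \<omega>)" "S 0 \<omega> = 0" "langevin_solution \<theta> (\<lambda>t. S t \<omega>) (\<lambda>t. X t \<omega>)"
    if "\<omega> \<in> space M" "\<omega> \<notin> N" for \<omega>
    using N(1) that by auto
  have mT: "T u \<in> borel_measurable M" for u
  proof -
    have "T u \<omega> = indicat_real (space M - N) \<omega> * S (max 0 u) \<omega>" if "\<omega> \<in> space M" for \<omega>
      using that by (auto simp: T_def indicator_def)
    moreover have "(\<lambda>\<omega>. indicat_real (space M - N) \<omega> * S (max 0 u) \<omega>) \<in> borel_measurable M"
      using N(3) by (intro borel_measurable_times borel_measurable_indicator mS) auto
    ultimately show ?thesis by (subst measurable_cong) auto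
  qed
  have TS: "AE \<omega> in M. T u \<omega> = S (max 0 u) \<omega>" for u
    using aeN by eventually_elim (simp add: T_def)
  have contT: "continuous_on UNIV (\<lambda>u. T u \<omega>)" if "\<omega> \<in> space M" for \<omega>
  proof (cases "\<omega> \<in> N")
    case False
    have "continuous_on UNIV (\<lambda>u. max 0 u :: real)" by (intro continuous_intros)
    from continuous_on_compose2[OF good(1)[OF that False] this] show ?thesis
      using False by (simp add: T_def image_subset_iff)
  qed (simp add: T_def)
  have sqT: "integrable M (\<lambda>\<omega>. (T u \<omega>)\<^sup>2)" for u
  proof -
    have "AE \<omega> in M. (S (max 0 u) \<omega>)\<^sup>2 = (T u \<omega>)\<^sup>2" using TS[of u] by eventually_elim simp
    from integrable_cong_AE_imp[OF sqS[of "max 0 u"] _ this] mT show ?thesis by simp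
  qed
  have covT: "expectation (\<lambda>\<omega>. T u \<omega> * T r \<omega>) = sfbm_cov (2 * H) u r" if "u \<ge> 0" "r \<ge> 0" for u r
  proof -
    have "expectation (\<lambda>\<omega>. T u \<omega> * T r \<omega>) = expectation (\<lambda>\<omega>. S u \<omega> * S r \<omega>)"
    proof (rule integral_cong_AE)
      show "AE \<omega> in M. T u \<omega> * T r \<omega> = S u \<omega> * S r \<omega>"
        using TS[of u] TS[of r] by eventually_elim (use that in simp)
    qed (use mT mS that in auto)
    then show ?thesis using cov that by simp
  qed
  let ?Z = "\<lambda>\<omega>. T t \<omega> - \<theta> * exp (- \<theta> * t) * integral {0..t} (\<lambda>r. exp (\<theta> * r) * T r \<omega>)"
  have XZ: "X t \<omega> = ?Z \<omega>" if "\<omega> \<in> space M" "\<omega> \<notin> N" for \<omega>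
  proof -
    have "integral {0..t} (\<lambda>r. exp (\<theta> * r) * T r \<omega>) = integral {0..t} (\<lambda>r. exp (\<theta> * r) * S r \<omega>)"
      using that by (intro Henstock_Kurzweil_Integration.integral_cong) (auto simp: T_def)
    moreover have "X t \<omega> = S t \<omega> - \<theta> * exp (- \<theta> * t) * integral {0..t} (\<lambda>r. exp (\<theta> * r) * S r \<omega>)"
      using langevin_solution_iff[OF good(1,2)[OF that], THEN iffD1, OF good(3)[OF that]] t by blast
    ultimately show ?thesis using that t by (simp add: T_def)
  qed
  have "(\<integral>\<omega>. (X t \<omega>)\<^sup>2 \<partial>M) = (\<integral>\<omega>. (?Z \<omega>)\<^sup>2 \<partial>M)"
  proof (rule integral_cong_AE)
    show "AE \<omega> in M. (X t \<omega>)\<^sup>2 = (?Z \<omega>)\<^sup>2"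
      using aeN AE_space by eventually_elim (simp add: XZ)
    have "X t \<in> borel_measurable M" using X t by (simp add: sub_fractional_OU_def)
    then show "(\<lambda>\<omega>. (X t \<omega>)\<^sup>2) \<in> borel_measurable M" by simp
    show "(\<lambda>\<omega>. (?Z \<omega>)\<^sup>2) \<in> borel_measurable M"
      by (intro borel_measurable_integrable ou_second_moment(1)[OF _ \<theta> mT contT sqT covT t]) (use H in simp)
  qed
  also have "\<dots> = sub_fOU_moment \<theta> (2 * H) t"
    using H by (intro ou_second_moment(2)[OF _ \<theta> mT contT sqT covT t]) auto
  finally show ?thesis .
qed

section \<open>Convergence rate of the averaged second moments\<close>

theorem proposition8:
  fixes M :: "'a measure" and S X :: "real \<Rightarrow> 'a \<Rightarrow> real" and H \<theta> :: real
  assumes "0 < H" and "H < 1" and "\<theta> > 0"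
    and "sub_fractional_BM M H S"
    and "sub_fractional_OU M \<theta> S X"
  shows "(\<exists>C>0. \<forall>t>0. \<bar>(\<integral>\<omega>. (X t \<omega>)\<^sup>2 \<partial>M) - f_lim H \<theta>\<bar> \<le> C * t powr (2 * H - 2)) \<and>
    (\<exists>C>0. \<forall>n::nat. n > 1 \<longrightarrow>
       sqrt (real n) * \<bar>mean_second_moment M X n - f_lim H \<theta>\<bar>
         \<le> C / sqrt (real n) * (\<Sum>i=1..n. real i powr (2 * H - 2)) \<and>
       sqrt (real n) * \<bar>mean_second_moment M X n - f_lim H \<theta>\<bar>
         \<le> C * (if H < 1 / 2 then real n powr (- 1 / 2)
                else if H = 1 / 2 then real n powr (- 1 / 2) * ln (real n)
                else real n powr (2 * H - 3 / 2))) \<and>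
    (H < 3 / 4 \<longrightarrow>
       (\<lambda>n. sqrt (real n) * \<bar>mean_second_moment M X n - f_lim H \<theta>\<bar>) \<longlonglongrightarrow> 0)"
proof -
  define E where "E t = (\<integral>\<omega>. (X t \<omega>)\<^sup>2 \<partial>M)" for t
  define f where "f = f_lim H \<theta>"
  define \<Delta> where "\<Delta> n = sqrt (real n) * \<bar>mean_second_moment M X n - f\<bar>" for n
  define \<Sigma> where "\<Sigma> n = (\<Sum>i=1..n. real i powr (2 * H - 2))" for n :: nat
  define g where "g n = (if H < 1 / 2 then real n powr (- 1 / 2)
                else if H = 1 / 2 then real n powr (- 1 / 2) * ln (real n)
                else real n powr (2 * H - 3 / 2))" for n :: nat
  \<comment> \<open>With \<open>p = 2 * H\<close>, the limit in \<open>sub_fOU_moment_bound\<close>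
    is \<open>f_lim H \<theta>\<close>, and \<open>p < 2\<close> is \<open>H < 1\<close>.\<close>
  obtain C where C: "C > 0" "\<And>t. t > 0 \<Longrightarrow> \<bar>E t - f\<bar> \<le> C * t powr (2 * H - 2)"
    using sub_fOU_moment_bound[of "2 * H" \<theta>] assms(1-3) sub_fractional_OU_second_moment[OF assms(1,3-5)]
    by (auto simp: E_def f_def f_lim_def)
  obtain K where K: "K > 0" "\<And>n. n > 1 \<Longrightarrow> \<Sigma> n / sqrt (real n) \<le> K * g n"
    using sum_powr_rate[OF assms(2)] unfolding \<Sigma>_def g_def by blast
  have g0: "g n \<ge> 0" for n by (cases n) (auto simp: g_def)
  have \<Delta>: "\<Delta> n \<le> C / sqrt (real n) * \<Sigma> n" if n: "n > 1" for n
  proof -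
    have "mean_second_moment M X n - f = (\<Sum>i=1..n. E (real i) - f) / real n"
      using n by (simp add: mean_second_moment_def E_def sum_subtractf diff_divide_distrib)
    also have "\<bar>\<dots>\<bar> \<le> (\<Sum>i=1..n. \<bar>E (real i) - f\<bar>) / real n"
      by (simp add: divide_right_mono sum_abs)
    also have "\<dots> \<le> (\<Sum>i=1..n. C * real i powr (2 * H - 2)) / real n"
      by (intro divide_right_mono sum_mono C(2)) auto
    also have "\<dots> = C * \<Sigma> n / real n" by (simp add: \<Sigma>_def sum_distrib_left)
    finally have "\<Delta> n \<le> sqrt (real n) * (C * \<Sigma> n / real n)"
      unfolding \<Delta>_def by (intro mult_left_mono) auto
    also have "\<dots> = C / sqrt (real n) * \<Sigma> n"
      using n real_sqrt_mult_self[of "real n"] by (simp add: field_simps flip: power2_eq_square)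
    finally show ?thesis .
  qed
  have \<Delta>g: "\<Delta> n \<le> C * K * g n" if n: "n > 1" for n
  proof -
    have "\<Delta> n \<le> C * (\<Sigma> n / sqrt (real n))" using \<Delta>[OF n] by simp
    also have "\<dots> \<le> C * (K * g n)" using K(2)[OF n] C(1) by (intro mult_left_mono) auto
    finally show ?thesis by simp
  qed
  have \<Sigma>0: "\<Sigma> n \<ge> 0" for n by (auto simp: \<Sigma>_def intro!: sum_nonneg)
  \<comment> \<open>The maximum lets one constant serve both bounds.\<close>
  define C' where "C' = max C (C * K)"
  have "C' > 0" using C(1) by (simp add: C'_def)
  moreover have "\<Delta> n \<le> C' / sqrt (real n) * \<Sigma> n \<and> \<Delta> n \<le> C' * g n" if "n > 1" for n
  proof
    show "\<Delta> n \<le> C' / sqrt (real n) * \<Sigma> n"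
      by (rule order_trans[OF \<Delta>[OF that]]) (auto simp: C'_def intro!: mult_right_mono divide_right_mono \<Sigma>0)
    show "\<Delta> n \<le> C' * g n"
      by (rule order_trans[OF \<Delta>g[OF that]]) (auto simp: C'_def intro!: mult_right_mono g0)
  qed
  moreover have "\<Delta> \<longlonglongrightarrow> 0" if H: "H < 3 / 4"
  proof (rule tendsto_sandwich[of "\<lambda>_. 0" _ _ "\<lambda>n. C * K * g n"])
    show "\<forall>\<^sub>F n in sequentially. \<Delta> n \<le> C * K * g n"
      using eventually_gt_at_top[of 1] by eventually_elim (rule \<Delta>g)
    have "g \<longlonglongrightarrow> 0"
    proof -
      consider "H < 1 / 2" | "H = 1 / 2" | "H > 1 / 2" by linarith
      then show ?thesis
      proof cases
        case 1
        then have g: "g = (\<lambda>n. real n powr (- 1 / 2))" by (auto simp: g_def)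
        show ?thesis unfolding g by real_asymp
      next
        case 2
        then have g: "g = (\<lambda>n. real n powr (- 1 / 2) * ln (real n))" by (auto simp: g_def)
        show ?thesis unfolding g by real_asymp
      next
        case 3
        then have g: "g = (\<lambda>n. real n powr (2 * H - 3 / 2))" by (auto simp: g_def)
        \<comment> \<open>This is where \<open>H < 3 / 4\<close> enters: it makes the exponent
          \<open>2 * H - 3 / 2\<close> negative.\<close>
        show ?thesis unfolding g using H by real_asymp
      qed
    qed
    then show "(\<lambda>n. C * K * g n) \<longlonglongrightarrow> 0" by (rule tendsto_mult_right_zero)
  qed (auto simp: \<Delta>_def)
  ultimately show ?thesis
    using C unfolding \<Delta>_def \<Sigma>_def g_def E_def f_def by blast
qed

end
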